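(* Let $\{X_\lambda:\lambda\in\Lambda\}$ be a nonempty family of nonzero Banach spaces over the same field ($\mathbb{R}$ or $\mathbb{C}$), let $1\leq p<\infty$ and $k\in\mathbb{N}$, and let \[X\in\Big\{[\oplus_{\lambda\in\Lambda}X_\lambda]_{\ell_1},\ [\oplus_{\lambda\in\Lambda}X_\lambda]_{\ell_\infty},\ [\oplus_{\lambda\in\Lambda}X_\lambda]_{c_0}\Big\}.\] Then the following are true. (i) If $n(X)=1$ and $n_{(p,k)}(X_{\lambda_0})=\frac{1}{k^{1/p}}$ for some $\lambda_0\in\Lambda$, then $n_{(p,k)}(X)=\frac{1}{k^{1/p}}$. (ii) If $n_{(p,k)}(X_\lambda)=\frac{n(X_\lambda)}{k^{1/p}}$ for each $\lambda\in\Lambda$, then $n_{(p,k)}(X)=\frac{n(X)}{k^{1/p}}$.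
   Context: $[\oplus_{\lambda\in\Lambda}X_\lambda]_{\ell_q}$ and $[\oplus_{\lambda\in\Lambda}X_\lambda]_{c_0}$ denote the $\ell_q$-sum and the $c_0$-sum of the family (the $c_0$-sum carries the supremum norm). For a Banach space $X$, $L(X)$ is the space of bounded linear operators on $X$ with the operator norm, $S_X$ its unit sphere, $X^*$ its dual, and $\Pi_X=\{(x,x^* )\in S_X\times S_{X^*}: x^*(x)=1\}$. For $T\in L(X)$, $w(T)=\sup\{|x^*(Tx)|:(x,x^* )\in\Pi_X\}$, and the numerical index is $n(X)=\inf\{w(T):T\in L(X),\|T\|=1\}$. For $1\leq p<\infty$, $k\in\mathbb{N}$ and $\mathcal{T}=(T_1,\ldots,T_k)\in L(X)^k$, put $\|\mathcal{T}\|_p=\sup\{(\sum_{i=1}^k\|T_ix\|^p)^{1/p}:x\in S_X\}$ and $w_p(\mathcal{T})=\sup\{(\sum_{i=1}^k|x^*(T_ix)|^p)^{1/p}:(x,x^* )\in\Pi_X\}$. The $(p,k)$-th joint numerical index of $X$ is $n_{(p,k)}(X)=\inf\{w_p(\mathcal{T}):\mathcal{T}\in L(X)^k,\ \|\mathcal{T}\|_p=1\}$. *)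

theory Defs
  imports "HOL-Analysis.Analysis" "HOL-Algebra.Module"
begin

section \<open>The scalar fields\<close>

text \<open>Up to isometric field isomorphism, the instances of this class are exactly \<open>real\<close> and
  \<open>complex\<close>.\<close>

class real_or_complex = real_normed_field +
  assumes real_or_complex:
    "(\<exists>h :: 'a \<Rightarrow> real. bij h \<and> (\<forall>x y. h (x + y) = h x + h y) \<and>
        (\<forall>x y. h (x * y) = h x * h y) \<and> (\<forall>x. norm (h x) = norm x)) \<or>
     (\<exists>h :: 'a \<Rightarrow> complex. bij h \<and> (\<forall>x y. h (x + y) = h x + h y) \<and>
        (\<forall>x y. h (x * y) = h x * h y) \<and> (\<forall>x. norm (h x) = norm x))"

instance real :: real_or_complex
  by standard (rule disjI1, rule exI[of _ id], simp)

instance complex :: real_or_complex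
  by standard (rule disjI2, rule exI[of _ id], simp)

section \<open>Banach spaces with explicit carriers\<close>

text \<open>Members of one family of Banach spaces must be able to differ as spaces, so the structure is a
  record on a carrier set, not a type class. The fields \<open>mult\<close> and \<open>one\<close> inherited from the
  module record carry no meaning for vectors and occur in no condition below.\<close>

record ('k, 'v) nvs = "('k, 'v) module" +
  nrm :: "'v \<Rightarrow> real"

text \<open>The scalar field serves both as the coefficient ring and as the codomain of functionals.\<close>

definition scalars :: "('k::real_or_complex, 'k) nvs" where
  "scalars = \<lparr>carrier = UNIV, mult = (*), one = 1, zero = 0, add = (+), smult = (*), nrm = norm\<rparr>"

locale normed_space = module "scalars :: ('k::real_or_complex, 'k) nvs" V
  for V :: "('k::real_or_complex, 'v) nvs" (structure) +
  assumes nrm_eq_zero: "x \<in> carrier V \<Longrightarrow> nrm V x = 0 \<longleftrightarrow> x = \<zero>"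
    and nrm_triangle: "\<lbrakk>x \<in> carrier V; y \<in> carrier V\<rbrakk> \<Longrightarrow> nrm V (x \<oplus> y) \<le> nrm V x + nrm V y"
    and nrm_smult: "x \<in> carrier V \<Longrightarrow> nrm V (a \<odot> x) = norm a * nrm V x"

locale banach_space = normed_space V for V :: "('k::real_or_complex, 'v) nvs" (structure) +
  assumes complete:
    "\<lbrakk>\<forall>n. s n \<in> carrier V; \<forall>e>0. \<exists>N::nat. \<forall>m\<ge>N. \<forall>n\<ge>N. nrm V (s m \<ominus> s n) < e\<rbrakk>
      \<Longrightarrow> \<exists>l\<in>carrier V. (\<lambda>n. nrm V (s n \<ominus> l)) \<longlonglongrightarrow> 0"

definition unit_sphere :: "('k, 'v) nvs \<Rightarrow> 'v set" where
  "unit_sphere V = {x \<in> carrier V. nrm V x = 1}"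

section \<open>Bounded operators and the dual\<close>

text \<open>Values outside the carrier are unconstrained. Nothing below depends on them.\<close>

definition bounded_operators :: "('k, 'v) nvs \<Rightarrow> ('k, 'w) nvs \<Rightarrow> ('v \<Rightarrow> 'w) set" where
  "bounded_operators V W = {T \<in> carrier V \<rightarrow> carrier W.
     (\<forall>x\<in>carrier V. \<forall>y\<in>carrier V. T (x \<oplus>\<^bsub>V\<^esub> y) = T x \<oplus>\<^bsub>W\<^esub> T y) \<and>
     (\<forall>a. \<forall>x\<in>carrier V. T (a \<odot>\<^bsub>V\<^esub> x) = a \<odot>\<^bsub>W\<^esub> T x) \<and>
     (\<exists>C. \<forall>x\<in>carrier V. nrm W (T x) \<le> C * nrm V x)}"

definition op_norm :: "('k, 'v) nvs \<Rightarrow> ('k, 'w) nvs \<Rightarrow> ('v \<Rightarrow> 'w) \<Rightarrow> real" where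
  "op_norm V W T = Sup {nrm W (T x) | x. x \<in> carrier V \<and> nrm V x \<le> 1}"

abbreviation dual :: "('k::real_or_complex, 'v) nvs \<Rightarrow> ('v \<Rightarrow> 'k) set" where
  "dual V \<equiv> bounded_operators V scalars"

definition dual_sphere :: "('k::real_or_complex, 'v) nvs \<Rightarrow> ('v \<Rightarrow> 'k) set" where
  "dual_sphere V = {f \<in> dual V. op_norm V scalars f = 1}"

definition Pi_states :: "('k::real_or_complex, 'v) nvs \<Rightarrow> ('v \<times> ('v \<Rightarrow> 'k)) set" where
  "Pi_states V = {(x, f). x \<in> unit_sphere V \<and> f \<in> dual_sphere V \<and> f x = 1}"

section \<open>Numerical indices\<close>

definition numerical_radius :: "('k::real_or_complex, 'v) nvs \<Rightarrow> ('v \<Rightarrow> 'v) \<Rightarrow> real" where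
  "numerical_radius V T = Sup {norm (f (T x)) | x f. (x, f) \<in> Pi_states V}"

definition numerical_index :: "('k::real_or_complex, 'v) nvs \<Rightarrow> real" where
  "numerical_index V =
     Inf {numerical_radius V T | T. T \<in> bounded_operators V V \<and> op_norm V V T = 1}"

text \<open>A \<open>k\<close>-tuple of operators is a function on the indices \<open>i < k\<close>.\<close>

definition joint_norm :: "real \<Rightarrow> nat \<Rightarrow> ('k, 'v) nvs \<Rightarrow> (nat \<Rightarrow> 'v \<Rightarrow> 'v) \<Rightarrow> real" where
  "joint_norm p k V T =
     Sup {(\<Sum>i<k. nrm V (T i x) powr p) powr (1 / p) | x. x \<in> unit_sphere V}"

definition joint_numerical_radius ::
    "real \<Rightarrow> nat \<Rightarrow> ('k::real_or_complex, 'v) nvs \<Rightarrow> (nat \<Rightarrow> 'v \<Rightarrow> 'v) \<Rightarrow> real" where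
  "joint_numerical_radius p k V T =
     Sup {(\<Sum>i<k. norm (f (T i x)) powr p) powr (1 / p) | x f. (x, f) \<in> Pi_states V}"

definition joint_numerical_index :: "real \<Rightarrow> nat \<Rightarrow> ('k::real_or_complex, 'v) nvs \<Rightarrow> real" where
  "joint_numerical_index p k V =
     Inf {joint_numerical_radius p k V T | T.
       (\<forall>i<k. T i \<in> bounded_operators V V) \<and> joint_norm p k V T = 1}"

section \<open>Sums of families of spaces\<close>

text \<open>The index set is a type, hence nonempty. \<open>sum_structure X C N\<close> has the coordinatewise operations
  of the family \<open>X\<close>, carrier \<open>C\<close> and norm \<open>N\<close>.\<close>

definition sum_structure ::
    "('i \<Rightarrow> ('k, 'v) nvs) \<Rightarrow> ('i \<Rightarrow> 'v) set \<Rightarrow> (('i \<Rightarrow> 'v) \<Rightarrow> real) \<Rightarrow> ('k, 'i \<Rightarrow> 'v) nvs" where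
  "sum_structure X C N = \<lparr>carrier = C,
     mult = (\<lambda>x y i. x i \<otimes>\<^bsub>X i\<^esub> y i), one = (\<lambda>i. \<one>\<^bsub>X i\<^esub>),
     zero = (\<lambda>i. \<zero>\<^bsub>X i\<^esub>), add = (\<lambda>x y i. x i \<oplus>\<^bsub>X i\<^esub> y i),
     smult = (\<lambda>a x i. a \<odot>\<^bsub>X i\<^esub> x i), nrm = N\<rparr>"

definition l1_sum :: "('i \<Rightarrow> ('k, 'v) nvs) \<Rightarrow> ('k, 'i \<Rightarrow> 'v) nvs" where
  "l1_sum X = sum_structure X
     {x. (\<forall>i. x i \<in> carrier (X i)) \<and> (\<lambda>i. nrm (X i) (x i)) summable_on UNIV}
     (\<lambda>x. \<Sum>\<^sub>\<infinity>i. nrm (X i) (x i))"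

definition linf_sum :: "('i \<Rightarrow> ('k, 'v) nvs) \<Rightarrow> ('k, 'i \<Rightarrow> 'v) nvs" where
  "linf_sum X = sum_structure X
     {x. (\<forall>i. x i \<in> carrier (X i)) \<and> bdd_above (range (\<lambda>i. nrm (X i) (x i)))}
     (\<lambda>x. SUP i. nrm (X i) (x i))"

definition c0_sum :: "('i \<Rightarrow> ('k, 'v) nvs) \<Rightarrow> ('k, 'i \<Rightarrow> 'v) nvs" where
  "c0_sum X = sum_structure X
     {x. (\<forall>i. x i \<in> carrier (X i)) \<and> (\<forall>e>0. finite {i. nrm (X i) (x i) \<ge> e})}
     (\<lambda>x. SUP i. nrm (X i) (x i))"

end

theory Submission
  imports Defs
begin

text \<open>
  Every nonzero space satisfies \<open>numerical_index V / k powr (1 / p) \<le> joint_numerical_index p k V\<close>, because a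
  tuple of joint norm 1 has \<open>numerical_index V * norm (T i x)\<close> bounded by its joint numerical radius
  for each \<open>i\<close>. Extending a tuple from a summand to the sum by zero does not increase its joint
  numerical radius, since the restriction to the summand of a state of the sum is a multiple of a
  state; hence the joint index of the sum is at most that of each summand. These two bounds give (i). For
  (ii) one also needs the theorem of Martin and Paya that the numerical index of the sum is at least
  the infimum of those of the summands: an operator on the sum is compressed to a summand by a rank
  one perturbation that keeps its norm and does not increase its numerical radius. Norming
  functionals are needed throughout; they come from a minimal sublinear functional.
\<close>

text \<open>A functional on an l_infinity sum need not be determined by its restrictions to the
  summands. The arguments therefore rest on splitting the sum into one summand and its complement,
  and the way the two norms combine, by addition or by maximum, is the main distinction among the
  three sums. Neither operator norms nor the infimum defining an index need be attained. Estimates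
  are hence made in homogeneous form: a bound \<open>w\<close> for |f (S u)| over all states gives
  \<open>numerical_index V * nrm V (S x) \<le> w\<close> at each x of the unit ball. The compression
  is chosen anew for each vector at which the operator is estimated, and so that every state of the
  summand lifts to a state of the sum with the same value. On an l1 type sum the functional is
  extended by a term on the complement; on a sup type sum the vector is. In (ii) the lower bound for
  the index of the sum is applied to the number k^(1/p) n_(p,k)(X), which the hypothesis places
  below every index of a summand.\<close>

lemma scalars_simps [simp]:
  "carrier scalars = UNIV" "add scalars = (+)" "monoid.mult scalars = (*)"
  "zero scalars = 0" "one scalars = 1" "smult scalars = (*)" "nrm scalars = norm"
  by (simp_all add: scalars_def)

lemma cring_scalars: "cring (scalars :: ('k::real_or_complex, 'k) nvs)"
proof (rule cringI)
  show "abelian_group (scalars :: ('k, 'k) nvs)"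
    by (rule abelian_groupI) (auto simp: algebra_simps intro: exI[of _ "- x" for x])
  show "Group.comm_monoid (scalars :: ('k, 'k) nvs)"
    by (rule comm_monoidI) (auto simp: algebra_simps)
qed (auto simp: algebra_simps)

lemma normed_space_scalars: "normed_space (scalars :: ('k::real_or_complex, 'k) nvs)"
proof -
  interpret cring "scalars :: ('k, 'k) nvs" by (rule cring_scalars)
  show ?thesis
    by unfold_locales (auto simp: algebra_simps norm_mult norm_triangle_ineq)
qed

section \<open>The scalar field: rotations and real coordinates\<close>

lemma exists_unimodular_factor:
  fixes z :: "'k::real_normed_field"
  obtains u where "norm u = 1" "u * z = of_real (norm z)"
proof (cases "z = 0")
  case True
  then show ?thesis using that[of 1] by simp
next
  case False
  then show ?thesis using that[of "of_real (norm z) / z"] by (simp add: norm_divide)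
qed

text \<open>Expanding |g r - g 1|^2 = (r - 1)^2 shows that the inner product of g r and g 1 is r, an
  equality case of Cauchy-Schwarz. The scalar class provides only an additive and multiplicative
  isometry, so its compatibility with \<open>of_real\<close> has to be derived from this.\<close>

lemma isometric_real_embedding:
  fixes g :: "real \<Rightarrow> 'a::real_inner"
  assumes "\<And>r s. g (r + s) = g r + g s" "\<And>r. norm (g r) = \<bar>r\<bar>"
  shows "g r = r *\<^sub>R g 1"
proof -
  have self: "g s \<bullet> g s = s\<^sup>2" for s
    using assms(2)[of s] by (metis power2_abs power2_norm_eq_inner)
  have "g (r - 1) = g r - g 1" using assms(1)[of "r - 1" 1] by simp
  then have "(norm (g r - g 1))\<^sup>2 = (r - 1)\<^sup>2" using assms(2)[of "r - 1"] by simp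
  moreover have "(norm (g r - g 1))\<^sup>2 = r\<^sup>2 - 2 * (g r \<bullet> g 1) + 1"
    using self[of r] self[of 1]
    by (simp add: power2_norm_eq_inner inner_diff_left inner_diff_right inner_commute)
  ultimately have inner: "g r \<bullet> g 1 = r" by (simp add: power2_eq_square algebra_simps)
  have "(norm (g r - r *\<^sub>R g 1))\<^sup>2 = (norm (g r))\<^sup>2 - 2 * (r * (g r \<bullet> g 1)) + r\<^sup>2 * (norm (g 1))\<^sup>2"
    unfolding power2_norm_eq_inner
    by (simp add: inner_diff_left inner_diff_right inner_commute power2_eq_square algebra_simps)
  also have "\<dots> = 0" by (simp add: inner assms(2) power2_eq_square)
  finally show ?thesis by simp
qed

text \<open>Norming functionals are assembled from real ones inside the type \<open>'k\<close>,
  which requires real coordinates there. The norm formula of the second case makes real parts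
  unique.\<close>

lemma real_or_complex_cases:
  "(\<forall>z::'k::real_or_complex. \<exists>a. z = of_real a) \<or>
   (\<exists>i::'k. i * i = - 1 \<and> (\<forall>z. \<exists>a b. z = of_real a + of_real b * i) \<and>
      (\<forall>a b. norm (of_real a + of_real b * i) = sqrt (a\<^sup>2 + b\<^sup>2)))"
  using real_or_complex[where 'a='k]
proof (elim disjE exE conjE)
  fix h :: "'k \<Rightarrow> real"
  assume h: "bij h" "\<forall>x y. h (x + y) = h x + h y" "\<forall>x y. h (x * y) = h x * h y"
    "\<forall>x. norm (h x) = norm x"
  have one: "h 1 = 1" using h(3,4) by (metis mult_cancel_left2 norm_one norm_zero zero_neq_one mult_1)
  have "h (of_real r) = r" for r
    using isometric_real_embedding[of "\<lambda>r. h (of_real r)" r] h(2,4) one by simp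
  then have "z = of_real (h z)" for z using h(1) by (metis bij_pointE)
  then show ?thesis by blast
next
  fix h :: "'k \<Rightarrow> complex"
  assume h: "bij h" "\<forall>x y. h (x + y) = h x + h y" "\<forall>x y. h (x * y) = h x * h y"
    "\<forall>x. norm (h x) = norm x"
  have one: "h 1 = 1" using h(3,4) by (metis mult_cancel_left2 norm_one norm_zero zero_neq_one mult_1)
  have re: "h (of_real r) = of_real r" for r
    using isometric_real_embedding[of "\<lambda>r. h (of_real r)" r] h(2,4) one by (simp add: scaleR_conv_of_real)
  have inj: "x = y" if "h x = h y" for x y using h(1) that by (metis bij_pointE)
  obtain i where i: "h i = \<i>" using h(1) by (metis bij_pointE)
  have eq: "h (of_real a + of_real b * i) = Complex a b" for a b
    using h(2,3) by (simp add: re i complex_eq_iff)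
  show ?thesis
  proof (intro disjI2 exI[of _ i] conjI allI)
    show "i * i = - 1"
      by (rule inj) (use h(3) re[of "- 1"] i in simp)
    fix z show "\<exists>a b. z = of_real a + of_real b * i"
      by (intro exI[of _ "Re (h z)"] exI[of _ "Im (h z)"] inj) (simp add: eq)
    fix a b show "norm (of_real a + of_real b * i) = sqrt (a\<^sup>2 + b\<^sup>2)"
      using h(4)[rule_format, of "of_real a + of_real b * i"] by (simp add: eq complex_norm)
  qed
qed

section \<open>Arithmetic and unit directions in a normed space\<close>

context normed_space
begin

lemma carrier_smult [simp, intro]: "x \<in> carrier V \<Longrightarrow> a \<odot> x \<in> carrier V"
  using smult_closed by simp

lemma smult_add_left: "x \<in> carrier V \<Longrightarrow> (a + b) \<odot> x = a \<odot> x \<oplus> b \<odot> x"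
  using smult_l_distr[of a b x] by simp

lemma smult_add_right: "x \<in> carrier V \<Longrightarrow> y \<in> carrier V \<Longrightarrow> a \<odot> (x \<oplus> y) = a \<odot> x \<oplus> a \<odot> y"
  using smult_r_distr[of a x y] by simp

lemma smult_smult: "x \<in> carrier V \<Longrightarrow> a \<odot> (b \<odot> x) = (a * b) \<odot> x"
  using smult_assoc1[of a b x] by simp

lemma one_smult [simp]: "x \<in> carrier V \<Longrightarrow> 1 \<odot> x = x"
  using smult_one by simp

lemma zero_smult [simp]: "x \<in> carrier V \<Longrightarrow> 0 \<odot> x = \<zero>"
  using smult_l_null by simp

lemma smult_zero [simp]: "a \<odot> \<zero> = \<zero>"
  using smult_r_null by simp

lemma add_uminus_smult [simp]: "x \<in> carrier V \<Longrightarrow> x \<oplus> (- 1) \<odot> x = \<zero>"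
  using smult_add_left[of x 1 "- 1"] by simp

lemma nrm_zero [simp]: "nrm V \<zero> = 0"
  using nrm_eq_zero[of \<zero>] by simp

lemma nrm_nonneg [simp]: "x \<in> carrier V \<Longrightarrow> 0 \<le> nrm V x"
  using nrm_triangle[of x "(- 1) \<odot> x"] nrm_smult[of x "- 1"] by simp

lemma nrm_pos: "x \<in> carrier V \<Longrightarrow> x \<noteq> \<zero> \<Longrightarrow> 0 < nrm V x"
  using nrm_eq_zero[of x] nrm_nonneg[of x] by linarith

text \<open>The zero vector also receives a direction, an arbitrary unit vector, so that later
  scaling arguments run without a case distinction.\<close>

lemma exists_unit_direction:
  assumes "x \<in> carrier V" "carrier V \<noteq> {\<zero>}"
  obtains u where "u \<in> carrier V" "nrm V u = 1" "x = of_real (nrm V x) \<odot> u"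
proof -
  have dir: "\<exists>u\<in>carrier V. nrm V u = 1 \<and> z = of_real (nrm V z) \<odot> u"
    if z: "z \<in> carrier V" "z \<noteq> \<zero>" for z
  proof (intro bexI conjI)
    have pos: "0 < nrm V z" using z by (rule nrm_pos)
    then show "nrm V (of_real (1 / nrm V z) \<odot> z) = 1"
      using z by (simp add: nrm_smult norm_divide)
    show "z = of_real (nrm V z) \<odot> (of_real (1 / nrm V z) \<odot> z)"
      using z pos by (simp add: smult_smult flip: of_real_mult)
  qed (use z in auto)
  show ?thesis
  proof (cases "x = \<zero>")
    case True
    obtain z where "z \<in> carrier V" "z \<noteq> \<zero>" using assms(2) zero_closed by blast
    with dir obtain u where "u \<in> carrier V" "nrm V u = 1" by blast
    then show ?thesis using True by (intro that) auto
  next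
    case False
    then show ?thesis using dir[OF assms(1)] that by blast
  qed
qed

section \<open>Norming functionals\<close>

text \<open>Values off the carrier are pinned to 0 because the order on total functions compares
  them too; left free, they could be lowered forever and no minimal element would exist.\<close>

definition sublinear :: "('v \<Rightarrow> real) \<Rightarrow> bool" where
  "sublinear q \<longleftrightarrow>
     (\<forall>x\<in>carrier V. \<forall>y\<in>carrier V. q (x \<oplus> y) \<le> q x + q y) \<and>
     (\<forall>t>0. \<forall>x\<in>carrier V. q (of_real t \<odot> x) = t * q x) \<and>
     (\<forall>x\<in>carrier V. q x \<le> nrm V x) \<and> (\<forall>x. x \<notin> carrier V \<longrightarrow> q x = 0)"

text \<open>One inequality suffices for homogeneity: applied to \<open>1 / t\<close> and the scaled
  vector it becomes the reverse one.\<close>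

lemma sublinearI:
  assumes "\<And>x y. x \<in> carrier V \<Longrightarrow> y \<in> carrier V \<Longrightarrow> q (x \<oplus> y) \<le> q x + q y"
    and le: "\<And>t x. 0 < t \<Longrightarrow> x \<in> carrier V \<Longrightarrow> q (of_real t \<odot> x) \<le> t * q x"
    and "\<And>x. x \<in> carrier V \<Longrightarrow> q x \<le> nrm V x"
    and "\<And>x. x \<notin> carrier V \<Longrightarrow> q x = 0"
  shows "sublinear q"
proof -
  have "q (of_real t \<odot> x) = t * q x" if "0 < t" "x \<in> carrier V" for t x
  proof (rule antisym)
    have "q x \<le> (1 / t) * q (of_real t \<odot> x)"
      using le[of "1 / t" "of_real t \<odot> x"] that by (simp add: smult_smult flip: of_real_mult)
    then show "t * q x \<le> q (of_real t \<odot> x)" using that by (simp add: field_simps)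
  qed (rule le[OF that])
  then show ?thesis unfolding sublinear_def using assms by blast
qed

lemma sublinearD:
  assumes "sublinear q"
  shows "x \<in> carrier V \<Longrightarrow> y \<in> carrier V \<Longrightarrow> q (x \<oplus> y) \<le> q x + q y"
    and "0 < t \<Longrightarrow> x \<in> carrier V \<Longrightarrow> q (of_real t \<odot> x) = t * q x"
    and "x \<in> carrier V \<Longrightarrow> q x \<le> nrm V x"
    and "x \<notin> carrier V \<Longrightarrow> q x = 0"
  using assms unfolding sublinear_def by blast+

lemma sublinear_zero: "sublinear q \<Longrightarrow> q \<zero> = 0"
  using sublinearD(2)[of q 2 \<zero>] by simp

lemma sublinear_nonneg_smult:
  "sublinear q \<Longrightarrow> 0 \<le> t \<Longrightarrow> x \<in> carrier V \<Longrightarrow> q (of_real t \<odot> x) = t * q x"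
  using sublinearD(2)[of q t x] sublinear_zero[of q] by (cases "t = 0") auto

text \<open>From 0 = q (x - x) and the bound of q by the norm. It keeps the pointwise infimum over a
  chain finite.\<close>

lemma sublinear_lower: "sublinear q \<Longrightarrow> x \<in> carrier V \<Longrightarrow> - nrm V x \<le> q x"
  using sublinearD(1)[of q x "(- 1) \<odot> x"] sublinearD(3)[of q "(- 1) \<odot> x"] sublinear_zero[of q]
  by (simp add: nrm_smult)

text \<open>The auxiliary functional in the proof of Hahn-Banach by minimality. Its term t = 1 at -v
  equals -q v, so a functional that coincides with its shift is linear along v.\<close>

definition shift :: "'v \<Rightarrow> ('v \<Rightarrow> real) \<Rightarrow> 'v \<Rightarrow> real" where
  "shift v q x = (if x \<in> carrier V then INF t\<in>{0..}. q (x \<oplus> of_real t \<odot> v) - t * q v else 0)"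

text \<open>Subadditivity on t v = (x + t v) - x gives a lower bound that is the same for all
  t.\<close>

lemma shift_bdd_below:
  assumes q: "sublinear q" and [simp]: "v \<in> carrier V" "x \<in> carrier V"
  shows "bdd_below ((\<lambda>t. q (x \<oplus> of_real t \<odot> v) - t * q v) ` {0..})"
proof (rule bdd_belowI2)
  fix t :: real assume "t \<in> {0..}"
  then have t: "0 \<le> t" by simp
  have "(x \<oplus> of_real t \<odot> v) \<oplus> (- 1) \<odot> x = (x \<oplus> (- 1) \<odot> x) \<oplus> of_real t \<odot> v"
    by (simp only: a_ac carrier_smult assms a_closed)
  then have "(x \<oplus> of_real t \<odot> v) \<oplus> (- 1) \<odot> x = of_real t \<odot> v" by simp
  then have "t * q v \<le> q (x \<oplus> of_real t \<odot> v) + q ((- 1) \<odot> x)"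
    using sublinearD(1)[OF q, of "x \<oplus> of_real t \<odot> v" "(- 1) \<odot> x"]
      sublinear_nonneg_smult[OF q t, of v] by simp
  then show "- nrm V x \<le> q (x \<oplus> of_real t \<odot> v) - t * q v"
    using sublinearD(3)[OF q, of "(- 1) \<odot> x"] by (simp add: nrm_smult)
qed

lemma shift_le:
  assumes "sublinear q" "v \<in> carrier V" "x \<in> carrier V" "0 \<le> t"
  shows "shift v q x \<le> q (x \<oplus> of_real t \<odot> v) - t * q v"
  using cINF_lower[OF shift_bdd_below[OF assms(1-3)], of t] assms by (simp add: shift_def)

lemma le_shift:
  assumes "x \<in> carrier V" "\<And>t. 0 \<le> t \<Longrightarrow> c \<le> q (x \<oplus> of_real t \<odot> v) - t * q v"
  shows "c \<le> shift v q x"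
  unfolding shift_def using assms by (auto intro!: cINF_greatest)

lemma shift_below: "sublinear q \<Longrightarrow> v \<in> carrier V \<Longrightarrow> shift v q \<le> q"
  using shift_le[of q v _ 0] sublinearD(4)[of q] by (auto simp: le_fun_def shift_def)

text \<open>Parameters add, (x + s v) + (y + t v) = (x + y) + (s + t) v, and they scale along with
  x. As s and t range independently over the nonnegative reals, the infimum inherits both
  properties.\<close>

lemma sublinear_shift:
  assumes q: "sublinear q" and v[simp]: "v \<in> carrier V"
  shows "sublinear (shift v q)"
proof (rule sublinearI)
  fix x y assume [simp]: "x \<in> carrier V" "y \<in> carrier V"
  have "shift v q (x \<oplus> y) - (q (y \<oplus> of_real t \<odot> v) - t * q v) \<le> shift v q x" if t: "0 \<le> t" for t
  proof (rule le_shift)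
    fix s :: real assume s: "0 \<le> s"
    have "(x \<oplus> y) \<oplus> of_real (s + t) \<odot> v = (x \<oplus> of_real s \<odot> v) \<oplus> (y \<oplus> of_real t \<odot> v)"
      by (simp add: smult_add_left a_ac)
    then have "shift v q (x \<oplus> y) \<le> q ((x \<oplus> of_real s \<odot> v) \<oplus> (y \<oplus> of_real t \<odot> v)) - (s + t) * q v"
      using shift_le[OF q v, of "x \<oplus> y" "s + t"] s t by simp
    also have "\<dots> \<le> q (x \<oplus> of_real s \<odot> v) + q (y \<oplus> of_real t \<odot> v) - (s + t) * q v"
      using sublinearD(1)[OF q] by simp
    finally show "shift v q (x \<oplus> y) - (q (y \<oplus> of_real t \<odot> v) - t * q v)
        \<le> q (x \<oplus> of_real s \<odot> v) - s * q v"
      by (simp add: algebra_simps)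
  qed simp
  then have "shift v q (x \<oplus> y) - shift v q x \<le> shift v q y"
    by (intro le_shift) (auto simp: algebra_simps)
  then show "shift v q (x \<oplus> y) \<le> shift v q x + shift v q y" by simp
next
  fix t :: real and x assume t: "0 < t" and x[simp]: "x \<in> carrier V"
  have "shift v q (of_real t \<odot> x) / t \<le> shift v q x"
  proof (rule le_shift)
    fix s :: real assume s: "0 \<le> s"
    have "of_real t \<odot> x \<oplus> of_real (t * s) \<odot> v = of_real t \<odot> (x \<oplus> of_real s \<odot> v)"
      by (simp add: smult_add_right smult_smult)
    then have "shift v q (of_real t \<odot> x) \<le> t * (q (x \<oplus> of_real s \<odot> v) - s * q v)"
      using shift_le[OF q v, of "of_real t \<odot> x" "t * s"] sublinearD(2)[OF q t] s t
      by (simp add: algebra_simps)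
    then show "shift v q (of_real t \<odot> x) / t \<le> q (x \<oplus> of_real s \<odot> v) - s * q v"
      using t by (simp add: field_simps)
  qed simp
  then show "shift v q (of_real t \<odot> x) \<le> t * shift v q x" using t by (simp add: field_simps)
next
  fix x assume "x \<in> carrier V"
  then show "shift v q x \<le> nrm V x"
    using le_funD[OF shift_below[OF q v], of x] sublinearD(3)[OF q, of x] by simp
qed (simp add: shift_def)

lemma sublinear_nrm: "sublinear (\<lambda>x. if x \<in> carrier V then nrm V x else 0)"
  by (rule sublinearI) (auto simp: nrm_triangle nrm_smult)

lemma exists_minimal_sublinear:
  assumes p: "sublinear p"
  obtains q where "sublinear q" "q \<le> p" "\<And>r. sublinear r \<Longrightarrow> r \<le> q \<Longrightarrow> r = q"
proof -
  define A where "A = {q. sublinear q \<and> q \<le> p}"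
  have "\<exists>m\<in>A. \<forall>a\<in>A. a \<le> m \<longrightarrow> a = m"
  \<comment> \<open>The rule produces maximal elements, so the order is reversed.\<close>
  proof (rule predicate_Zorn)
    show "partial_order_on A (relation_of (\<lambda>a b. b \<le> a) A)"
      by (rule partial_order_on_relation_ofI) auto
  next
    fix C assume C: "C \<in> Chains (relation_of (\<lambda>a b. b \<le> a) A)"
    then have CA: "C \<subseteq> A" and tot: "\<And>a b. a \<in> C \<Longrightarrow> b \<in> C \<Longrightarrow> a \<le> b \<or> b \<le> a"
      unfolding Chains_def relation_of_def by auto
    show "\<exists>u\<in>A. \<forall>a\<in>C. u \<le> a"
    proof (cases "C = {}")
      case True
      then show ?thesis using p by (auto simp: A_def)
    next
      case ne: False
      have sub: "sublinear q" "q \<le> p" if "q \<in> C" for q using that CA by (auto simp: A_def)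
      define u where "u x = (if x \<in> carrier V then INF q\<in>C. q x else 0)" for x
      have low: "u x \<le> q x" if "q \<in> C" for q x
      proof (cases "x \<in> carrier V")
        case True
        have "bdd_below ((\<lambda>q. q x) ` C)"
          using sublinear_lower[OF sub(1) True] by (intro bdd_belowI2)
        then show ?thesis using that True cINF_lower[of "\<lambda>q. q x" C q] by (simp add: u_def)
      next
        case False
        then show ?thesis using sublinearD(4)[OF sub(1)[OF that]] by (simp add: u_def)
      qed
      have great: "c \<le> u x" if "x \<in> carrier V" "\<And>q. q \<in> C \<Longrightarrow> c \<le> q x" for c x
        using that ne by (auto simp: u_def intro: cINF_greatest)
      have "sublinear u"
      proof (rule sublinearI)
        fix x y assume [simp]: "x \<in> carrier V" "y \<in> carrier V"
        \<comment> \<open>The infimum of two sublinear functionals need not be subadditive; in a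
          chain the smaller of a and b serves for both.\<close>
        have *: "u (x \<oplus> y) \<le> a x + b y" if ab: "a \<in> C" "b \<in> C" for a b
        proof -
          obtain c where c: "c \<in> C" "c \<le> a" "c \<le> b" using tot[OF ab] ab by auto
          have "u (x \<oplus> y) \<le> c x + c y"
            using low[OF c(1), of "x \<oplus> y"] sublinearD(1)[OF sub(1)[OF c(1)], of x y] by simp
          also have "\<dots> \<le> a x + b y" using c by (simp add: le_fun_def add_mono)
          finally show ?thesis .
        qed
        have "u (x \<oplus> y) - u y \<le> u x"
        proof (rule great)
          fix a assume a: "a \<in> C"
          have "u (x \<oplus> y) - a x \<le> u y" using *[OF a] by (intro great) (auto simp: algebra_simps)
          then show "u (x \<oplus> y) - u y \<le> a x" by simp
        qed simp
        then show "u (x \<oplus> y) \<le> u x + u y" by simp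
      next
        fix t :: real and x assume t: "0 < t" and x: "x \<in> carrier V"
        have "u (of_real t \<odot> x) / t \<le> u x"
        proof (rule great[OF x])
          fix q assume "q \<in> C"
          then show "u (of_real t \<odot> x) / t \<le> q x"
            using low[of q "of_real t \<odot> x"] sublinearD(2)[OF sub(1) t x] t by (simp add: field_simps)
        qed
        then show "u (of_real t \<odot> x) \<le> t * u x" using t by (simp add: field_simps)
      next
        fix x assume x: "x \<in> carrier V"
        obtain q where "q \<in> C" using ne by blast
        then show "u x \<le> nrm V x" using low[of q x] sublinearD(3)[OF sub(1) x, of q] by simp
      qed (simp add: u_def)
      moreover have "u \<le> p"
        using ne low sub(2) by (meson equals0I le_fun_def order_trans)
      ultimately show ?thesis using low by (auto simp: A_def le_fun_def)
    qed
  qed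
  then obtain m where m: "m \<in> A" "\<And>a. a \<in> A \<Longrightarrow> a \<le> m \<Longrightarrow> a = m" by blast
  show ?thesis using m by (intro that[of m]) (auto simp: A_def)
qed

text \<open>A minimal sublinear functional coincides with all of its shifts, which makes it additive.\<close>

lemma exists_real_norming_functional:
  assumes x0: "x0 \<in> carrier V"
  obtains q where "\<And>x y. x \<in> carrier V \<Longrightarrow> y \<in> carrier V \<Longrightarrow> q (x \<oplus> y) = q x + q y"
    "\<And>t x. x \<in> carrier V \<Longrightarrow> q (of_real t \<odot> x) = t * q x"
    "\<And>x. x \<in> carrier V \<Longrightarrow> q x \<le> nrm V x" "q x0 = nrm V x0"
proof -
  let ?n = "\<lambda>x. if x \<in> carrier V then nrm V x else 0"
  \<comment> \<open>Minimality is sought below the shift of the norm along x0. At -x0 that shift is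
    at most -nrm V x0, which forces q x0 = nrm V x0.\<close>
  obtain q where q: "sublinear q" "q \<le> shift x0 ?n" "\<And>r. sublinear r \<Longrightarrow> r \<le> q \<Longrightarrow> r = q"
    using exists_minimal_sublinear[OF sublinear_shift[OF sublinear_nrm x0]] by blast
  have add: "q (x \<oplus> y) = q x + q y" if x: "x \<in> carrier V" and y: "y \<in> carrier V" for x y
  proof (rule antisym)
    \<comment> \<open>The term t = 1 of the shift is the missing half of additivity.\<close>
    have "shift y q = q" using q sublinear_shift[OF q(1) y] shift_below[OF q(1) y] by blast
    then show "q x + q y \<le> q (x \<oplus> y)" using shift_le[OF q(1) y x, of 1] y by simp
  qed (rule sublinearD(1)[OF q(1) x y])
  have uminus: "q ((- 1) \<odot> x) = - q x" if "x \<in> carrier V" for x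
    using add[of x "(- 1) \<odot> x"] sublinear_zero[OF q(1)] that by simp
  have smult: "q (of_real t \<odot> x) = t * q x" if x: "x \<in> carrier V" for t x
  proof (cases "0 \<le> t")
    case True
    then show ?thesis using sublinear_nonneg_smult[OF q(1)] x by blast
  next
    case False
    then have "q (of_real (- t) \<odot> x) = - t * q x" using sublinear_nonneg_smult[OF q(1), of "- t" x] x by simp
    then show ?thesis using uminus[of "of_real (- t) \<odot> x"] x by (simp add: smult_smult)
  qed
  have "q ((- 1) \<odot> x0) \<le> shift x0 ?n ((- 1) \<odot> x0)" using q(2) by (simp add: le_fun_def)
  also have "\<dots> \<le> ?n ((- 1) \<odot> x0 \<oplus> of_real 1 \<odot> x0) - 1 * ?n x0"
    using x0 by (intro shift_le sublinear_nrm) auto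
  also have "(- 1) \<odot> x0 \<oplus> of_real 1 \<odot> x0 = \<zero>" using x0 by (simp add: a_comm)
  finally have "nrm V x0 \<le> q x0" using uminus[OF x0] x0 by simp
  then have "q x0 = nrm V x0" using sublinearD(3)[OF q(1) x0] by simp
  then show ?thesis using that[of q] add smult sublinearD(3)[OF q(1)] by blast
qed

text \<open>In the complex case f x = q x - i q (i x) is the complex functional with real part q.
  Rotating f x to a nonnegative real turns the bound on q into one on f.\<close>

lemma exists_norming_functional:
  assumes x0: "x0 \<in> carrier V"
  obtains f where "f \<in> dual V" "\<And>x. x \<in> carrier V \<Longrightarrow> norm (f x) \<le> nrm V x"
    "f x0 = of_real (nrm V x0)"
proof -
  obtain q where q_add: "\<And>x y. x \<in> carrier V \<Longrightarrow> y \<in> carrier V \<Longrightarrow> q (x \<oplus> y) = q x + q y"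
    and q_smult: "\<And>t x. x \<in> carrier V \<Longrightarrow> q (of_real t \<odot> x) = t * q x"
    and q_le: "\<And>x. x \<in> carrier V \<Longrightarrow> q x \<le> nrm V x" and q_x0: "q x0 = nrm V x0"
    using exists_real_norming_functional[OF x0] by blast
  have q_uminus: "q ((- 1) \<odot> x) = - q x" if "x \<in> carrier V" for x
    using q_smult[OF that, of "- 1"] by simp
  have q_abs: "\<bar>q x\<bar> \<le> nrm V x" if "x \<in> carrier V" for x
    using q_le[OF that] q_le[of "(- 1) \<odot> x"] q_uminus that by (simp add: abs_le_iff nrm_smult)
  have dualI: "f \<in> dual V" if "\<And>x y. x \<in> carrier V \<Longrightarrow> y \<in> carrier V \<Longrightarrow> f (x \<oplus> y) = f x + f y"
    "\<And>a x. x \<in> carrier V \<Longrightarrow> f (a \<odot> x) = a * f x"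
    "\<And>x. x \<in> carrier V \<Longrightarrow> norm (f x) \<le> nrm V x" for f :: "'v \<Rightarrow> 'k"
    unfolding bounded_operators_def using that by (auto intro!: exI[of _ 1])
  from real_or_complex_cases[where 'k='k] show ?thesis
  proof
    assume real: "\<forall>z::'k. \<exists>a. z = of_real a"
    define f where "f x = (of_real (q x) :: 'k)" for x
    have f_smult: "f (a \<odot> x) = a * f x" if x: "x \<in> carrier V" for a x
    proof -
      obtain r where "a = of_real r" using real by blast
      then show ?thesis using q_smult[OF x, of r] by (simp add: f_def)
    qed
    show ?thesis
      using dualI[of f] f_smult q_add q_abs q_x0 by (intro that[of f]) (auto simp: f_def)
  next
    assume "\<exists>i::'k. i * i = - 1 \<and> (\<forall>z. \<exists>a b. z = of_real a + of_real b * i) \<and>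
      (\<forall>a b. norm (of_real a + of_real b * i) = sqrt (a\<^sup>2 + b\<^sup>2))"
    then obtain i :: 'k where i: "i * i = - 1"
      and span: "\<And>z::'k. \<exists>a b. z = of_real a + of_real b * i"
      and norm_eq: "\<And>a b. norm (of_real a + of_real b * i) = sqrt (a\<^sup>2 + b\<^sup>2)"
      by blast
    define f where "f x = (of_real (q x) + of_real (- q (i \<odot> x)) * i :: 'k)" for x
    have f_add: "f (x \<oplus> y) = f x + f y" if "x \<in> carrier V" "y \<in> carrier V" for x y
      using that by (simp add: f_def q_add smult_add_right algebra_simps)
    have f_smult: "f (a \<odot> x) = a * f x" if x: "x \<in> carrier V" for a x
    proof -
      obtain r s where a: "a = of_real r + of_real s * i" using span by blast
      have ii: "i * (i * z) = - z" for z using i by (metis mult.assoc mult_minus1)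
      have 1: "a \<odot> x = of_real r \<odot> x \<oplus> of_real s \<odot> (i \<odot> x)"
        using x by (simp add: a smult_add_left smult_smult)
      have 2: "i \<odot> (a \<odot> x) = of_real r \<odot> (i \<odot> x) \<oplus> of_real (- s) \<odot> x"
        using x ii[of "of_real s"]
        by (simp add: a smult_smult algebra_simps flip: smult_add_left)
      \<comment> \<open>Fact 2 has to be unfolded first, since its left side contains that of fact
        1.\<close>
      show ?thesis unfolding f_def 2 unfolding 1 using x
        by (simp only: q_add q_smult carrier_smult) (simp add: a ii algebra_simps)
    qed
    have real_part: "r = r'" if "of_real r + of_real s * i = (of_real r' :: 'k)" for r s r'
    proof -
      have "of_real (r - r') + of_real s * i = (0 :: 'k)" using that by (simp add: algebra_simps)
      then have "sqrt ((r - r')\<^sup>2 + s\<^sup>2) = 0" using norm_eq[of "r - r'" s] by simp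
      then show ?thesis by (simp add: sum_power2_eq_zero_iff)
    qed
    have f_le: "norm (f x) \<le> nrm V x" if x: "x \<in> carrier V" for x
    proof -
      obtain u :: 'k where u: "norm u = 1" "u * f x = of_real (norm (f x))"
        by (rule exists_unimodular_factor)
      have "q (u \<odot> x) = norm (f x)"
        by (rule real_part[of _ "- q (i \<odot> (u \<odot> x))"])
           (use f_smult[OF x, of u] u(2) in \<open>simp add: f_def\<close>)
      then show ?thesis using q_le[of "u \<odot> x"] x u(1) by (simp add: nrm_smult)
    qed
    \<comment> \<open>The real part of f x0 already exhausts the bound, so the imaginary part
      vanishes.\<close>
    have "sqrt ((nrm V x0)\<^sup>2 + (q (i \<odot> x0))\<^sup>2) \<le> nrm V x0"
      using f_le[OF x0] norm_eq[of "q x0" "- q (i \<odot> x0)"] by (simp add: f_def q_x0)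
    then have "(nrm V x0)\<^sup>2 + (q (i \<odot> x0))\<^sup>2 \<le> (nrm V x0)\<^sup>2"
      using sqrt_le_D by blast
    then have "q (i \<odot> x0) = 0" by simp
    then have "f x0 = of_real (nrm V x0)" by (simp add: f_def q_x0)
    then show ?thesis using dualI[of f] f_add f_smult f_le by (intro that[of f]) auto
  qed
qed

end

section \<open>Operators and states\<close>

lemma bounded_operatorsI:
  assumes "\<And>x. x \<in> carrier V \<Longrightarrow> T x \<in> carrier W"
    and "\<And>x y. x \<in> carrier V \<Longrightarrow> y \<in> carrier V \<Longrightarrow> T (x \<oplus>\<^bsub>V\<^esub> y) = T x \<oplus>\<^bsub>W\<^esub> T y"
    and "\<And>a x. x \<in> carrier V \<Longrightarrow> T (a \<odot>\<^bsub>V\<^esub> x) = a \<odot>\<^bsub>W\<^esub> T x"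
    and "\<And>x. x \<in> carrier V \<Longrightarrow> nrm W (T x) \<le> C * nrm V x"
  shows "T \<in> bounded_operators V W"
  using assms unfolding bounded_operators_def by blast

lemma bounded_operatorsD:
  assumes "T \<in> bounded_operators V W"
  shows "x \<in> carrier V \<Longrightarrow> T x \<in> carrier W"
    and "x \<in> carrier V \<Longrightarrow> y \<in> carrier V \<Longrightarrow> T (x \<oplus>\<^bsub>V\<^esub> y) = T x \<oplus>\<^bsub>W\<^esub> T y"
    and "x \<in> carrier V \<Longrightarrow> T (a \<odot>\<^bsub>V\<^esub> x) = a \<odot>\<^bsub>W\<^esub> T x"
  using assms unfolding bounded_operators_def by auto

lemma bounded_operators_zero:
  assumes "normed_space V" "normed_space W" "T \<in> bounded_operators V W"
  shows "T \<zero>\<^bsub>V\<^esub> = \<zero>\<^bsub>W\<^esub>"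
proof -
  interpret V: normed_space V by fact
  interpret W: normed_space W by fact
  have "T (0 \<odot>\<^bsub>V\<^esub> \<zero>\<^bsub>V\<^esub>) = 0 \<odot>\<^bsub>W\<^esub> T \<zero>\<^bsub>V\<^esub>" by (rule bounded_operatorsD(3)[OF assms(3)]) simp
  then show ?thesis using bounded_operatorsD(1)[OF assms(3)] by simp
qed

lemma le_op_norm:
  assumes "normed_space V" "normed_space W" "T \<in> bounded_operators V W"
    and "x \<in> carrier V" "nrm V x \<le> 1"
  shows "nrm W (T x) \<le> op_norm V W T"
proof -
  interpret V: normed_space V by fact
  interpret W: normed_space W by fact
  obtain C where C: "\<And>x. x \<in> carrier V \<Longrightarrow> nrm W (T x) \<le> C * nrm V x"
    using assms(3) unfolding bounded_operators_def by blast
  have "nrm W (T y) \<le> \<bar>C\<bar>" if "y \<in> carrier V" "nrm V y \<le> 1" for y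
  proof -
    have "nrm W (T y) \<le> C * nrm V y" using C that by blast
    also have "\<dots> \<le> \<bar>C\<bar> * 1" using that by (intro mult_mono) auto
    finally show ?thesis by simp
  qed
  then have "bdd_above {nrm W (T x) |x. x \<in> carrier V \<and> nrm V x \<le> 1}"
    by (intro bdd_aboveI[of _ "\<bar>C\<bar>"]) auto
  then show ?thesis unfolding op_norm_def using assms(4,5) by (intro cSup_upper) auto
qed

lemma op_norm_leI:
  assumes "normed_space V" "\<And>x. x \<in> carrier V \<Longrightarrow> nrm V x \<le> 1 \<Longrightarrow> nrm W (T x) \<le> c"
  shows "op_norm V W T \<le> c"
proof -
  interpret V: normed_space V by fact
  have "\<exists>x. x \<in> carrier V \<and> nrm V x \<le> 1" by (intro exI[of _ "\<zero>\<^bsub>V\<^esub>"]) simp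
  then show ?thesis unfolding op_norm_def using assms(2) by (intro cSup_least) auto
qed

lemma op_norm_bound:
  assumes "normed_space V" "normed_space W" "T \<in> bounded_operators V W" "x \<in> carrier V"
  shows "nrm W (T x) \<le> op_norm V W T * nrm V x"
proof -
  interpret V: normed_space V by fact
  interpret W: normed_space W by fact
  show ?thesis
  proof (cases "x = \<zero>\<^bsub>V\<^esub>")
    case True
    then show ?thesis using bounded_operators_zero[OF assms(1-3)] by simp
  next
    case False
    then obtain u where u: "u \<in> carrier V" "nrm V u = 1" "x = of_real (nrm V x) \<odot>\<^bsub>V\<^esub> u"
      using V.exists_unit_direction[OF assms(4)] assms(4) by auto
    have "T x = of_real (nrm V x) \<odot>\<^bsub>W\<^esub> T u"
      using bounded_operatorsD(3)[OF assms(3) u(1), of "of_real (nrm V x)"] by (simp flip: u(3))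
    then have "nrm W (T x) = nrm V x * nrm W (T u)"
      using bounded_operatorsD(1)[OF assms(3) u(1)] assms(4) by (simp add: W.nrm_smult)
    also have "\<dots> \<le> nrm V x * op_norm V W T"
      using le_op_norm[OF assms(1-3) u(1)] u(2) assms(4) by (intro mult_left_mono) auto
    finally show ?thesis by (simp add: mult.commute)
  qed
qed

lemma op_norm_nonneg:
  assumes "normed_space V" "normed_space W" "T \<in> bounded_operators V W"
  shows "0 \<le> op_norm V W T"
proof -
  interpret V: normed_space V by fact
  interpret W: normed_space W by fact
  show ?thesis
    using le_op_norm[OF assms, of "\<zero>\<^bsub>V\<^esub>"] bounded_operators_zero[OF assms] by simp
qed

text \<open>Since f x = 1 at a unit vector forces the dual norm to be at least 1, membership in the
  dual sphere reduces to a pointwise bound. Later constructions of states verify this form.\<close>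

lemma Pi_states_iff:
  fixes V :: "('k::real_or_complex, 'v) nvs"
  assumes "normed_space V"
  shows "(x, f) \<in> Pi_states V \<longleftrightarrow> x \<in> carrier V \<and> nrm V x = 1 \<and> f \<in> dual V \<and>
    (\<forall>y\<in>carrier V. norm (f y) \<le> nrm V y) \<and> f x = 1"
proof
  assume "(x, f) \<in> Pi_states V"
  then have *: "x \<in> carrier V" "nrm V x = 1" "f \<in> dual V" "op_norm V scalars f = 1" "f x = 1"
    by (auto simp: Pi_states_def unit_sphere_def dual_sphere_def)
  then show "x \<in> carrier V \<and> nrm V x = 1 \<and> f \<in> dual V \<and>
    (\<forall>y\<in>carrier V. norm (f y) \<le> nrm V y) \<and> f x = 1"
    using op_norm_bound[OF assms normed_space_scalars *(3)] by auto
next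
  assume *: "x \<in> carrier V \<and> nrm V x = 1 \<and> f \<in> dual V \<and>
    (\<forall>y\<in>carrier V. norm (f y) \<le> nrm V y) \<and> f x = 1"
  have "op_norm V scalars f = 1"
  proof (rule antisym)
    show "op_norm V scalars f \<le> 1" using * by (intro op_norm_leI[OF assms]) force
    show "1 \<le> op_norm V scalars f"
      using le_op_norm[OF assms normed_space_scalars, of f x] * by simp
  qed
  then show "(x, f) \<in> Pi_states V"
    using * by (simp add: Pi_states_def unit_sphere_def dual_sphere_def)
qed

lemma dualI:
  fixes V :: "('k::real_or_complex, 'v) nvs"
  assumes "\<And>x y. x \<in> carrier V \<Longrightarrow> y \<in> carrier V \<Longrightarrow> f (x \<oplus>\<^bsub>V\<^esub> y) = f x + f y"
    and "\<And>a x. x \<in> carrier V \<Longrightarrow> f (a \<odot>\<^bsub>V\<^esub> x) = a * f x"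
    and "\<And>x. x \<in> carrier V \<Longrightarrow> norm (f x) \<le> C * nrm V x"
  shows "f \<in> dual V"
  using assms by (intro bounded_operatorsI[of _ _ _ C]) auto

lemma dualD:
  assumes "f \<in> dual V"
  shows "x \<in> carrier V \<Longrightarrow> y \<in> carrier V \<Longrightarrow> f (x \<oplus>\<^bsub>V\<^esub> y) = f x + f y"
    and "x \<in> carrier V \<Longrightarrow> f (a \<odot>\<^bsub>V\<^esub> x) = a * f x"
  using bounded_operatorsD[OF assms] by simp_all

section \<open>The lp norm of a tuple\<close>

definition lp_norm :: "real \<Rightarrow> nat \<Rightarrow> (nat \<Rightarrow> real) \<Rightarrow> real" where
  "lp_norm p k a = (\<Sum>i<k. a i powr p) powr (1 / p)"

lemma lp_norm_nonneg: "0 \<le> lp_norm p k a"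
  by (simp add: lp_norm_def)

lemma lp_norm_cong:
  assumes "\<And>i. i < k \<Longrightarrow> a i = b i"
  shows "lp_norm p k a = lp_norm p k b"
  using assms by (simp add: lp_norm_def)

lemma lp_norm_mono:
  assumes "0 < p" "\<And>i. i < k \<Longrightarrow> 0 \<le> a i" "\<And>i. i < k \<Longrightarrow> a i \<le> b i"
  shows "lp_norm p k a \<le> lp_norm p k b"
  unfolding lp_norm_def using assms by (intro powr_mono2 sum_mono sum_nonneg) auto

lemma lp_norm_scale:
  assumes "0 < p" "0 \<le> c" "\<And>i. i < k \<Longrightarrow> 0 \<le> a i"
  shows "lp_norm p k (\<lambda>i. c * a i) = c * lp_norm p k a"
proof -
  have "lp_norm p k (\<lambda>i. c * a i) = (c powr p * (\<Sum>i<k. a i powr p)) powr (1 / p)"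
    unfolding lp_norm_def sum_distrib_left using assms by (simp add: powr_mult)
  also have "\<dots> = c * lp_norm p k a"
    unfolding lp_norm_def using assms by (simp add: powr_mult powr_powr sum_nonneg)
  finally show ?thesis .
qed

text \<open>The source of the factor k^(1/p).\<close>

lemma lp_norm_const:
  assumes "0 < p" "0 \<le> c"
  shows "lp_norm p k (\<lambda>i. c) = real k powr (1 / p) * c"
  unfolding lp_norm_def using assms by (simp add: powr_mult powr_powr)

lemma le_lp_norm:
  assumes "0 < p" "i < k" "0 \<le> a i"
  shows "a i \<le> lp_norm p k a"
proof -
  have "a i = (a i powr p) powr (1 / p)" using assms by (simp add: powr_powr)
  also have "\<dots> \<le> lp_norm p k a"
    unfolding lp_norm_def using assms by (intro powr_mono2 member_le_sum) auto
  finally show ?thesis .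
qed

section \<open>Numerical indices of a single space\<close>

locale nontrivial_normed_space = normed_space V
  for V :: "('k::real_or_complex, 'v) nvs" (structure) +
  assumes nontrivial: "carrier V \<noteq> {\<zero>}"
begin

lemma exists_unit: obtains u where "u \<in> carrier V" "nrm V u = 1"
  by (rule exists_unit_direction[OF zero_closed nontrivial])

lemma exists_state:
  assumes "u \<in> carrier V" "nrm V u = 1"
  obtains f where "(u, f) \<in> Pi_states V"
proof -
  obtain f where "f \<in> dual V" "\<And>x. x \<in> carrier V \<Longrightarrow> norm (f x) \<le> nrm V x" "f u = of_real (nrm V u)"
    by (rule exists_norming_functional[OF assms(1)]) blast
  then show ?thesis
    using assms by (intro that[of f]) (simp add: Pi_states_iff[OF normed_space_axioms])
qed

text \<open>The supremum of an empty set of reals is unspecified; the existence of a state is what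
  makes upper bounds for numerical radii provable.\<close>

lemma Pi_states_nonempty: "\<exists>x f. (x, f) \<in> Pi_states V"
proof -
  obtain u where u: "u \<in> carrier V" "nrm V u = 1" by (rule exists_unit)
  obtain f where "(u, f) \<in> Pi_states V" by (rule exists_state[OF u])
  then show ?thesis by blast
qed

lemma state_bound:
  assumes "T \<in> bounded_operators V V" "(x, f) \<in> Pi_states V"
  shows "norm (f (T x)) \<le> nrm V (T x)"
  using assms(2) bounded_operatorsD(1)[OF assms(1)] Pi_states_iff[OF normed_space_axioms] by blast

lemma le_numerical_radius:
  assumes T: "T \<in> bounded_operators V V" and xf: "(x, f) \<in> Pi_states V"
  shows "norm (f (T x)) \<le> numerical_radius V T"
proof -
  have "norm (f (T x)) \<le> op_norm V V T" if "(x, f) \<in> Pi_states V" for x f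
    using state_bound[OF T that] le_op_norm[OF normed_space_axioms normed_space_axioms T, of x] that
    by (simp add: Pi_states_iff[OF normed_space_axioms])
  then have "bdd_above {norm (f (T x)) |x f. (x, f) \<in> Pi_states V}"
    by (intro bdd_aboveI[of _ "op_norm V V T"]) blast
  then show ?thesis unfolding numerical_radius_def using xf by (intro cSup_upper) blast
qed

lemma numerical_radius_leI:
  assumes "\<And>x f. (x, f) \<in> Pi_states V \<Longrightarrow> norm (f (T x)) \<le> w"
  shows "numerical_radius V T \<le> w"
  unfolding numerical_radius_def using assms Pi_states_nonempty by (intro cSup_least) auto

lemma numerical_radius_nonneg:
  assumes "T \<in> bounded_operators V V"
  shows "0 \<le> numerical_radius V T"
proof -
  obtain x f where "(x, f) \<in> Pi_states V" using Pi_states_nonempty by blast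
  from order_trans[OF norm_ge_zero le_numerical_radius[OF assms this]] show ?thesis .
qed

lemma id_bounded: "(\<lambda>x. x) \<in> bounded_operators V V"
  by (rule bounded_operatorsI[of _ _ _ 1]) auto

text \<open>The identity keeps the set in the definition of the index nonempty; on a trivial space
  no operator has norm 1.\<close>

lemma op_norm_id: "op_norm V V (\<lambda>x. x) = 1"
proof (rule antisym)
  show "op_norm V V (\<lambda>x. x) \<le> 1" by (rule op_norm_leI[OF normed_space_axioms])
  obtain u where "u \<in> carrier V" "nrm V u = 1" by (rule exists_unit)
  then show "1 \<le> op_norm V V (\<lambda>x. x)"
    using le_op_norm[OF normed_space_axioms normed_space_axioms id_bounded, of u] by simp
qed

lemma numerical_index_le:
  assumes "T \<in> bounded_operators V V" "op_norm V V T = 1"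
  shows "numerical_index V \<le> numerical_radius V T"
  unfolding numerical_index_def using assms numerical_radius_nonneg
  by (intro cInf_lower) (auto intro: bdd_belowI[of _ 0])

lemma le_numerical_index:
  assumes "\<And>T. T \<in> bounded_operators V V \<Longrightarrow> op_norm V V T = 1 \<Longrightarrow> c \<le> numerical_radius V T"
  shows "c \<le> numerical_index V"
  unfolding numerical_index_def using assms id_bounded op_norm_id
  by (intro cInf_greatest) auto

lemma numerical_index_nonneg: "0 \<le> numerical_index V"
  using numerical_radius_nonneg by (rule le_numerical_index)

lemma smult_bounded:
  assumes "T \<in> bounded_operators V V"
  shows "(\<lambda>x. a \<odot> T x) \<in> bounded_operators V V"
proof (rule bounded_operatorsI[of _ _ _ "norm a * op_norm V V T"])
  fix x assume x: "x \<in> carrier V"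
  have "norm a * nrm V (T x) \<le> norm a * (op_norm V V T * nrm V x)"
    by (intro mult_left_mono op_norm_bound normed_space_axioms assms x) simp
  then show "nrm V (a \<odot> T x) \<le> norm a * op_norm V V T * nrm V x"
    using bounded_operatorsD(1)[OF assms x] by (simp add: nrm_smult mult.assoc)
qed (use bounded_operatorsD[OF assms] in \<open>auto simp: smult_add_right smult_smult mult.commute\<close>)

text \<open>The definition of the index rescaled by the operator norm of S. In this form it applies
  to operators of any norm, including 0, and at a single vector, so that no norm has to be
  attained.\<close>

lemma numerical_index_mult_nrm_le:
  assumes S: "S \<in> bounded_operators V V" and x: "x \<in> carrier V" "nrm V x \<le> 1"
    and w: "\<And>u f. (u, f) \<in> Pi_states V \<Longrightarrow> norm (f (S u)) \<le> w"
  shows "numerical_index V * nrm V (S x) \<le> w"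
proof -
  let ?N = "op_norm V V S"
  note ns = normed_space_axioms
  have w0: "0 \<le> w" 
  proof (rule order_trans)
    show "numerical_radius V S \<le> w" by (rule numerical_radius_leI) (rule w)
  qed (rule numerical_radius_nonneg[OF S])
  have Sx: "nrm V (S x) \<le> ?N" by (rule le_op_norm[OF ns ns S x])
  show ?thesis
  proof (cases "?N = 0")
    case True
    then have "nrm V (S x) = 0"
      using Sx nrm_nonneg[OF bounded_operatorsD(1)[OF S x(1)]] by linarith
    then show ?thesis using w0 by simp
  next
    case False
    then have N: "0 < ?N" using op_norm_nonneg[OF ns ns S] by simp
    let ?a = "of_real (1 / ?N) :: 'k"
    let ?T = "\<lambda>x. ?a \<odot> S x"
    have T: "?T \<in> bounded_operators V V" by (rule smult_bounded[OF S])
    have nT: "nrm V (?T y) = nrm V (S y) / ?N" if "y \<in> carrier V" for y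
      using bounded_operatorsD(1)[OF S that] N by (simp add: nrm_smult norm_divide)
    have "op_norm V V ?T = 1"
    proof (rule antisym)
      show "op_norm V V ?T \<le> 1"
        using nT N le_op_norm[OF ns ns S] by (intro op_norm_leI[OF ns]) simp
      \<comment> \<open>As \<open>?N\<close> may fail to be attained, the scaling is undone
        pointwise.\<close>
      have "?N \<le> op_norm V V ?T * ?N"
      proof (rule op_norm_leI[OF ns])
        fix y assume y: "y \<in> carrier V" "nrm V y \<le> 1"
        have "nrm V (S y) = nrm V (?T y) * ?N" using nT[OF y(1)] N by simp
        also have "\<dots> \<le> op_norm V V ?T * ?N"
          by (intro mult_right_mono le_op_norm[OF ns ns T] y) (use N in simp)
        finally show "nrm V (S y) \<le> op_norm V V ?T * ?N" .
      qed
      then show "1 \<le> op_norm V V ?T" using N by simp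
    qed
    then have "numerical_index V \<le> numerical_radius V ?T" by (rule numerical_index_le[OF T])
    also have "\<dots> \<le> w / ?N"
    proof (rule numerical_radius_leI)
      fix u f assume uf: "(u, f) \<in> Pi_states V"
      then have u: "u \<in> carrier V" and f: "f \<in> dual V"
        by (simp_all add: Pi_states_iff[OF ns])
      have "norm (f (?T u)) = norm (f (S u)) / ?N"
        using dualD(2)[OF f bounded_operatorsD(1)[OF S u], of ?a] N by (simp add: norm_divide)
      then show "norm (f (?T u)) \<le> w / ?N" using w[OF uf] N by (simp add: divide_right_mono)
    qed
    finally have "numerical_index V * ?N \<le> w" using N by (simp add: field_simps)
    moreover have "numerical_index V * nrm V (S x) \<le> numerical_index V * ?N"
      by (intro mult_left_mono Sx numerical_index_nonneg)
    ultimately show ?thesis by simp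
  qed
qed

lemma joint_norm_eq:
  "joint_norm p k V T = Sup {lp_norm p k (\<lambda>i. nrm V (T i x)) |x. x \<in> unit_sphere V}"
  by (simp add: joint_norm_def lp_norm_def)

lemma joint_numerical_radius_eq:
  "joint_numerical_radius p k V T =
     Sup {lp_norm p k (\<lambda>i. norm (f (T i x))) |x f. (x, f) \<in> Pi_states V}"
  by (simp add: joint_numerical_radius_def lp_norm_def)

lemma le_joint_norm:
  assumes p: "0 < p" and T: "\<And>i. i < k \<Longrightarrow> T i \<in> bounded_operators V V"
    and x: "x \<in> carrier V" "nrm V x = 1"
  shows "lp_norm p k (\<lambda>i. nrm V (T i x)) \<le> joint_norm p k V T"
proof -
  note ns = normed_space_axioms
  have "lp_norm p k (\<lambda>i. nrm V (T i y)) \<le> lp_norm p k (\<lambda>i. op_norm V V (T i))"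
    if "y \<in> unit_sphere V" for y
    using that T bounded_operatorsD(1)[OF T] le_op_norm[OF ns ns T]
    by (intro lp_norm_mono[OF p]) (auto simp: unit_sphere_def)
  then have "bdd_above {lp_norm p k (\<lambda>i. nrm V (T i x)) |x. x \<in> unit_sphere V}"
    by (intro bdd_aboveI[of _ "lp_norm p k (\<lambda>i. op_norm V V (T i))"]) blast
  then show ?thesis
    unfolding joint_norm_eq using x by (intro cSup_upper) (auto simp: unit_sphere_def)
qed

lemma joint_norm_leI:
  assumes "\<And>x. x \<in> carrier V \<Longrightarrow> nrm V x = 1 \<Longrightarrow> lp_norm p k (\<lambda>i. nrm V (T i x)) \<le> c"
  shows "joint_norm p k V T \<le> c"
proof -
  obtain u where "u \<in> carrier V" "nrm V u = 1" by (rule exists_unit)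
  then show ?thesis
    unfolding joint_norm_eq using assms by (intro cSup_least) (auto simp: unit_sphere_def)
qed

lemma joint_norm_bound:
  assumes p: "0 < p" and T: "\<And>i. i < k \<Longrightarrow> T i \<in> bounded_operators V V"
    and x: "x \<in> carrier V"
  shows "lp_norm p k (\<lambda>i. nrm V (T i x)) \<le> joint_norm p k V T * nrm V x"
proof -
  obtain u where u: "u \<in> carrier V" "nrm V u = 1" "x = of_real (nrm V x) \<odot> u"
    by (rule exists_unit_direction[OF x nontrivial])
  have "nrm V (T i x) = nrm V x * nrm V (T i u)" if "i < k" for i
  proof -
    have "T i x = of_real (nrm V x) \<odot> T i u"
      using bounded_operatorsD(3)[OF T[OF that] u(1), of "of_real (nrm V x)"] by (simp flip: u(3))
    then show ?thesis
      using bounded_operatorsD(1)[OF T[OF that] u(1)] x by (simp add: nrm_smult)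
  qed
  then have "lp_norm p k (\<lambda>i. nrm V (T i x)) = lp_norm p k (\<lambda>i. nrm V x * nrm V (T i u))"
    by (rule lp_norm_cong)
  also have "\<dots> = nrm V x * lp_norm p k (\<lambda>i. nrm V (T i u))"
    using bounded_operatorsD(1)[OF T] x u(1) by (intro lp_norm_scale[OF p]) auto
  also have "\<dots> \<le> nrm V x * joint_norm p k V T"
    using le_joint_norm[where T = T and k = k, OF p T u(1,2)] x by (intro mult_left_mono) auto
  finally show ?thesis by (simp add: mult.commute)
qed

lemma le_joint_numerical_radius:
  assumes p: "0 < p" and T: "\<And>i. i < k \<Longrightarrow> T i \<in> bounded_operators V V"
    and xf: "(x, f) \<in> Pi_states V"
  shows "lp_norm p k (\<lambda>i. norm (f (T i x))) \<le> joint_numerical_radius p k V T"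
proof -
  have "lp_norm p k (\<lambda>i. norm (f (T i x))) \<le> joint_norm p k V T" if xf: "(x, f) \<in> Pi_states V" for x f
  proof -
    have "lp_norm p k (\<lambda>i. norm (f (T i x))) \<le> lp_norm p k (\<lambda>i. nrm V (T i x))"
      using state_bound[OF T xf] by (intro lp_norm_mono[OF p]) auto
    also have "\<dots> \<le> joint_norm p k V T"
      using xf by (intro le_joint_norm[OF p T]) (auto simp: Pi_states_iff[OF normed_space_axioms])
    finally show ?thesis .
  qed
  then have "bdd_above {lp_norm p k (\<lambda>i. norm (f (T i x))) |x f. (x, f) \<in> Pi_states V}"
    by (intro bdd_aboveI[of _ "joint_norm p k V T"]) blast
  then show ?thesis unfolding joint_numerical_radius_eq using xf by (intro cSup_upper) blast
qed

lemma joint_numerical_radius_leI: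
  assumes "\<And>x f. (x, f) \<in> Pi_states V \<Longrightarrow> lp_norm p k (\<lambda>i. norm (f (T i x))) \<le> w"
  shows "joint_numerical_radius p k V T \<le> w"
  unfolding joint_numerical_radius_eq using assms Pi_states_nonempty by (intro cSup_least) auto

lemma joint_numerical_radius_nonneg:
  assumes "0 < p" "\<And>i. i < k \<Longrightarrow> T i \<in> bounded_operators V V"
  shows "0 \<le> joint_numerical_radius p k V T"
proof -
  obtain x f where "(x, f) \<in> Pi_states V" using Pi_states_nonempty by blast
  from order_trans[OF lp_norm_nonneg le_joint_numerical_radius[OF assms this]] show ?thesis .
qed

lemma joint_numerical_index_le:
  assumes "0 < p" "\<And>i. i < k \<Longrightarrow> T i \<in> bounded_operators V V" "joint_norm p k V T = 1"
  shows "joint_numerical_index p k V \<le> joint_numerical_radius p k V T"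
  unfolding joint_numerical_index_def using assms joint_numerical_radius_nonneg[OF assms(1)]
  by (intro cInf_lower) (auto intro!: bdd_belowI[of _ 0])

lemma exists_joint_norm_one:
  assumes p: "0 < p" and k: "1 \<le> k"
  shows "\<exists>T. (\<forall>i. T i \<in> bounded_operators V V) \<and> joint_norm p k V T = 1"
proof -
  \<comment> \<open>The tuple (Id, 0, ..., 0); index 0 is in range because 1 \<le> k.\<close>
  define T where "T i = (\<lambda>x. (if i = 0 then 1 else 0) \<odot> x)" for i :: nat
  have T: "T i \<in> bounded_operators V V" for i
    unfolding T_def by (rule smult_bounded[OF id_bounded])
  have eq: "lp_norm p k (\<lambda>i. nrm V (T i x)) = 1" if "x \<in> carrier V" "nrm V x = 1" for x
  proof -
    have "(\<Sum>i<k. nrm V (T i x) powr p) = (\<Sum>i<k. if i = 0 then 1 else 0)"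
      using that p by (intro sum.cong) (auto simp: T_def)
    then show ?thesis using k by (simp add: lp_norm_def)
  qed
  obtain u where u: "u \<in> carrier V" "nrm V u = 1" by (rule exists_unit)
  have "joint_norm p k V T = 1"
  proof (rule antisym)
    show "joint_norm p k V T \<le> 1" using eq by (intro joint_norm_leI) simp
    show "1 \<le> joint_norm p k V T" using le_joint_norm[where T = T and k = k, OF p T u] eq[OF u] by simp
  qed
  then show ?thesis using T by blast
qed

lemma le_joint_numerical_index:
  assumes "0 < p" "1 \<le> k"
    and "\<And>T. (\<And>i. i < k \<Longrightarrow> T i \<in> bounded_operators V V) \<Longrightarrow> joint_norm p k V T = 1 \<Longrightarrow>
      c \<le> joint_numerical_radius p k V T"
  shows "c \<le> joint_numerical_index p k V"
proof -
  obtain T where "\<forall>i. T i \<in> bounded_operators V V" "joint_norm p k V T = 1"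
    using exists_joint_norm_one[OF assms(1,2)] by blast
  then show ?thesis
    unfolding joint_numerical_index_def using assms(3) by (intro cInf_greatest) auto
qed

text \<open>Bounding all k entries by the same w / n costs the factor k^(1/p); comparison with joint
  norm 1 gives the claim. The quotient w / n requires the case n = 0 to be set apart.\<close>

lemma numerical_index_le_joint:
  assumes p: "0 < p" and k: "1 \<le> k"
  shows "numerical_index V / real k powr (1 / p) \<le> joint_numerical_index p k V"
proof (rule le_joint_numerical_index[OF p k])
  fix T assume T: "\<And>i. i < k \<Longrightarrow> T i \<in> bounded_operators V V" and T1: "joint_norm p k V T = 1"
  define w n c where "w = joint_numerical_radius p k V T" and "n = numerical_index V"
    and "c = real k powr (1 / p)"
  have w0: "0 \<le> w" unfolding w_def by (rule joint_numerical_radius_nonneg[OF p T])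
  have c: "0 < c" using k by (simp add: c_def)
  have "n / c \<le> w"
  proof (cases "n = 0")
    case True
    then show ?thesis using w0 by simp
  next
    case False
    then have n: "0 < n" using numerical_index_nonneg by (simp add: n_def)
    have "joint_norm p k V T \<le> c * (w / n)"
    proof (rule joint_norm_leI)
      fix x assume x: "x \<in> carrier V" "nrm V x = 1"
      have "nrm V (T i x) \<le> w / n" if i: "i < k" for i
      proof -
        have "norm (f (T i u)) \<le> w" if uf: "(u, f) \<in> Pi_states V" for u f
          using le_lp_norm[OF p i, of "\<lambda>i. norm (f (T i u))"]
            le_joint_numerical_radius[where T = T and k = k, OF p T uf] by (simp add: w_def)
        then have "n * nrm V (T i x) \<le> w"
          unfolding n_def using x by (intro numerical_index_mult_nrm_le[OF T[OF i]]) auto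
        then show ?thesis using n by (simp add: field_simps)
      qed
      then have "lp_norm p k (\<lambda>i. nrm V (T i x)) \<le> lp_norm p k (\<lambda>i. w / n)"
        using bounded_operatorsD(1)[OF T x(1)] by (intro lp_norm_mono[OF p]) auto
      also have "\<dots> = c * (w / n)" unfolding c_def using w0 n by (intro lp_norm_const[OF p]) simp
      finally show "lp_norm p k (\<lambda>i. nrm V (T i x)) \<le> c * (w / n)" .
    qed
    then show ?thesis using T1 n c by (simp add: field_simps)
  qed
  then show "numerical_index V / real k powr (1 / p) \<le> joint_numerical_radius p k V T"
    by (simp only: n_def c_def w_def)
qed

end

section \<open>Operators built by composition, addition and rank one terms\<close>

lemma bounded_compose:
  assumes "normed_space V" "normed_space W" "normed_space U"
    and T: "T \<in> bounded_operators V W" and S: "S \<in> bounded_operators W U"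
  shows "(\<lambda>x. S (T x)) \<in> bounded_operators V U"
proof (rule bounded_operatorsI[of _ _ _ "op_norm W U S * op_norm V W T"])
  fix x assume x: "x \<in> carrier V"
  have "nrm U (S (T x)) \<le> op_norm W U S * nrm W (T x)"
    by (intro op_norm_bound assms bounded_operatorsD(1)[OF T] x)
  also have "\<dots> \<le> op_norm W U S * (op_norm V W T * nrm V x)"
    by (intro mult_left_mono op_norm_bound op_norm_nonneg assms x)
  finally show "nrm U (S (T x)) \<le> op_norm W U S * op_norm V W T * nrm V x"
    by (simp add: mult.assoc)
qed (simp_all add: bounded_operatorsD[OF T] bounded_operatorsD[OF S])

lemma bounded_add:
  assumes "normed_space V" "normed_space W"
    and T: "T \<in> bounded_operators V W" and S: "S \<in> bounded_operators V W"
  shows "(\<lambda>x. T x \<oplus>\<^bsub>W\<^esub> S x) \<in> bounded_operators V W"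
proof -
  interpret W: normed_space W by fact
  note D = bounded_operatorsD[OF T] bounded_operatorsD[OF S]
  show ?thesis
  proof (rule bounded_operatorsI[of _ _ _ "op_norm V W T + op_norm V W S"])
    fix x assume x: "x \<in> carrier V"
    show "nrm W (T x \<oplus>\<^bsub>W\<^esub> S x) \<le> (op_norm V W T + op_norm V W S) * nrm V x"
      using W.nrm_triangle[of "T x" "S x"] D x
        op_norm_bound[OF assms(1,2) T x] op_norm_bound[OF assms(1,2) S x]
      by (simp add: algebra_simps)
  next
    fix x y assume xy: "x \<in> carrier V" "y \<in> carrier V"
    have "T x \<in> carrier W" "S x \<in> carrier W" "T y \<in> carrier W" "S y \<in> carrier W"
      using D xy by auto
    then show "T (x \<oplus>\<^bsub>V\<^esub> y) \<oplus>\<^bsub>W\<^esub> S (x \<oplus>\<^bsub>V\<^esub> y) = T x \<oplus>\<^bsub>W\<^esub> S x \<oplus>\<^bsub>W\<^esub> (T y \<oplus>\<^bsub>W\<^esub> S y)"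
      using D(2,5) xy by (simp add: W.a_ac)
  qed (simp_all add: D W.smult_add_right)
qed

lemma bounded_rank_one:
  assumes "normed_space V" "normed_space W" "f \<in> dual V" "w \<in> carrier W"
  shows "(\<lambda>x. f x \<odot>\<^bsub>W\<^esub> w) \<in> bounded_operators V W"
proof -
  interpret W: normed_space W by fact
  show ?thesis
  proof (rule bounded_operatorsI[of _ _ _ "op_norm V scalars f * nrm W w"])
    fix x assume x: "x \<in> carrier V"
    have "norm (f x) * nrm W w \<le> op_norm V scalars f * nrm V x * nrm W w"
      using op_norm_bound[OF assms(1) normed_space_scalars assms(3) x] assms(4)
      by (intro mult_right_mono) auto
    then show "nrm W (f x \<odot>\<^bsub>W\<^esub> w) \<le> op_norm V scalars f * nrm W w * nrm V x"
      using assms(4) by (simp add: W.nrm_smult mult_ac)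
  qed (simp_all add: assms(4) dualD[OF assms(3)] W.smult_add_left W.smult_smult)
qed

section \<open>Sums of spaces\<close>

text \<open>What the three sums share, phrased through single coordinates so that summability and
  suprema stay out of the common arguments. The primed assumptions are spelled out because
  \<open>single\<close> is defined only inside the locale.\<close>

locale coordinate_sum =
  fixes X :: "'i \<Rightarrow> ('k::real_or_complex, 'v) nvs" and Y :: "('k, 'i \<Rightarrow> 'v) nvs"
  assumes X: "nontrivial_normed_space (X i)"
    and Y: "normed_space Y"
    and zero_Y: "\<zero>\<^bsub>Y\<^esub> = (\<lambda>i. \<zero>\<^bsub>X i\<^esub>)"
    and add_Y: "x \<oplus>\<^bsub>Y\<^esub> y = (\<lambda>i. x i \<oplus>\<^bsub>X i\<^esub> y i)"
    and smult_Y: "a \<odot>\<^bsub>Y\<^esub> y = (\<lambda>i. a \<odot>\<^bsub>X i\<^esub> y i)"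
    and coord_carrier [simp]: "y \<in> carrier Y \<Longrightarrow> y i \<in> carrier (X i)"
    and single_carrier': "v \<in> carrier (X i) \<Longrightarrow> (\<lambda>j. if j = i then v else \<zero>\<^bsub>X j\<^esub>) \<in> carrier Y"
    and nrm_single': "v \<in> carrier (X i) \<Longrightarrow>
      nrm Y (\<lambda>j. if j = i then v else \<zero>\<^bsub>X j\<^esub>) = nrm (X i) v"
    and nrm_coord_le: "y \<in> carrier Y \<Longrightarrow> nrm (X i) (y i) \<le> nrm Y y"
begin

sublocale Y: normed_space Y by (rule Y)
sublocale X: nontrivial_normed_space "X i" for i by (rule X)

definition single :: "'i \<Rightarrow> 'v \<Rightarrow> 'i \<Rightarrow> 'v" where
  "single i v = (\<lambda>j. if j = i then v else \<zero>\<^bsub>X j\<^esub>)"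

definition drop :: "'i \<Rightarrow> ('i \<Rightarrow> 'v) \<Rightarrow> 'i \<Rightarrow> 'v" where
  "drop i y = y(i := \<zero>\<^bsub>X i\<^esub>)"

lemma single_carrier [simp]: "v \<in> carrier (X i) \<Longrightarrow> single i v \<in> carrier Y"
  using single_carrier' by (simp add: single_def)

lemma nrm_single [simp]: "v \<in> carrier (X i) \<Longrightarrow> nrm Y (single i v) = nrm (X i) v"
  using nrm_single' by (simp add: single_def)

lemma single_same [simp]: "single i v i = v"
  by (simp add: single_def)

lemma drop_same [simp]: "drop i y i = \<zero>\<^bsub>X i\<^esub>"
  by (simp add: drop_def)

lemma single_add_drop: "y \<in> carrier Y \<Longrightarrow> single i (y i) \<oplus>\<^bsub>Y\<^esub> drop i y = y"
  by (auto simp: single_def drop_def add_Y fun_eq_iff)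

lemma drop_eq: "y \<in> carrier Y \<Longrightarrow> drop i y = y \<oplus>\<^bsub>Y\<^esub> (- 1) \<odot>\<^bsub>Y\<^esub> single i (y i)"
  by (auto simp: single_def drop_def add_Y smult_Y fun_eq_iff)

lemma drop_carrier [simp]: "y \<in> carrier Y \<Longrightarrow> drop i y \<in> carrier Y"
  by (simp add: drop_eq)

lemma drop_single [simp]: "drop i (single i v) = \<zero>\<^bsub>Y\<^esub>"
  by (auto simp: single_def drop_def zero_Y)

lemma single_add_coord:
  "v \<in> carrier (X i) \<Longrightarrow> y i = \<zero>\<^bsub>X i\<^esub> \<Longrightarrow> (single i v \<oplus>\<^bsub>Y\<^esub> y) i = v"
  by (simp add: add_Y)

lemma drop_single_add:
  "y \<in> carrier Y \<Longrightarrow> y i = \<zero>\<^bsub>X i\<^esub> \<Longrightarrow> drop i (single i v \<oplus>\<^bsub>Y\<^esub> y) = y"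
  by (auto simp: add_Y single_def drop_def fun_eq_iff)

lemma single_bounded: "single i \<in> bounded_operators (X i) Y"
proof (rule bounded_operatorsI[of _ _ _ 1])
  fix v assume "v \<in> carrier (X i)"
  then show "single i v \<in> carrier Y" by simp
qed (auto simp: single_def add_Y smult_Y fun_eq_iff nrm_single')

lemma coord_bounded: "(\<lambda>y. y i) \<in> bounded_operators Y (X i)"
  by (rule bounded_operatorsI[of _ _ _ 1]) (auto simp: add_Y smult_Y nrm_coord_le)

lemma drop_bounded: "drop i \<in> bounded_operators Y Y"
\<comment> \<open>The constant 2 comes from writing the operator as y minus its i-th part, each of
  norm at most that of y.\<close>
proof (rule bounded_operatorsI[of _ _ _ 2])
  fix y assume y: "y \<in> carrier Y"
  show "nrm Y (drop i y) \<le> 2 * nrm Y y"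
    using Y.nrm_triangle[of y "(- 1) \<odot>\<^bsub>Y\<^esub> single i (y i)"] nrm_coord_le[OF y, of i] y
    by (simp add: drop_eq Y.nrm_smult)
next
  fix y assume "y \<in> carrier Y"
  then show "drop i y \<in> carrier Y" by simp
qed (auto simp: drop_def add_Y smult_Y)

lemma Y_nontrivial: "nontrivial_normed_space Y"
proof
  fix i :: 'i
  obtain u where "u \<in> carrier (X i)" "nrm (X i) u = 1" by (rule X.exists_unit)
  then have "nrm Y (single i u) = 1" "single i u \<in> carrier Y" by auto
  then show "carrier Y \<noteq> {\<zero>\<^bsub>Y\<^esub>}" by force
qed

sublocale Y: nontrivial_normed_space Y by (rule Y_nontrivial)

lemma Y_states: "(y, f) \<in> Pi_states Y \<longleftrightarrow> y \<in> carrier Y \<and> nrm Y y = 1 \<and> f \<in> dual Y \<and>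
    (\<forall>z\<in>carrier Y. norm (f z) \<le> nrm Y z) \<and> f y = 1"
  by (rule Pi_states_iff[OF Y])

lemma X_states: "(x, f) \<in> Pi_states (X i) \<longleftrightarrow> x \<in> carrier (X i) \<and> nrm (X i) x = 1 \<and>
    f \<in> dual (X i) \<and> (\<forall>z\<in>carrier (X i). norm (f z) \<le> nrm (X i) z) \<and> f x = 1"
  by (rule Pi_states_iff[OF X.normed_space_axioms])

text \<open>The hypothesis says that the restriction of the functional to the summand, after
  normalisation, is a state at the normalised coordinate.\<close>

lemma joint_numerical_index_le_summand:
  assumes norming: "\<And>y f v. (y, f) \<in> Pi_states Y \<Longrightarrow> v \<in> carrier (X i) \<Longrightarrow>
      norm (f (single i v)) * nrm (X i) (y i) \<le> norm (f (single i (y i))) * nrm (X i) v"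
    and p: "0 < p" and k: "1 \<le> k"
  shows "joint_numerical_index p k Y \<le> joint_numerical_index p k (X i)"
proof (rule X.le_joint_numerical_index[OF p k])
  fix T assume T: "\<And>n. n < k \<Longrightarrow> T n \<in> bounded_operators (X i) (X i)"
    and T1: "joint_norm p k (X i) T = 1"
  note XI = X.normed_space_axioms[of i]
  let ?w = "joint_numerical_radius p k (X i) T"
  define R where "R n y = single i (T n (y i))" for n y
  have R: "R n \<in> bounded_operators Y Y" if "n < k" for n
    unfolding R_def
    using bounded_compose[OF Y XI Y coord_bounded
        bounded_compose[OF XI XI Y T[OF that] single_bounded]] by simp
  have nR: "nrm Y (R n y) = nrm (X i) (T n (y i))" if "n < k" "y \<in> carrier Y" for n y
    using bounded_operatorsD(1)[OF T] that by (simp add: R_def)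
  have "joint_norm p k Y R = 1"
  proof (rule antisym)
    show "joint_norm p k Y R \<le> 1"
    proof (rule Y.joint_norm_leI)
      fix y assume y: "y \<in> carrier Y" "nrm Y y = 1"
      have "lp_norm p k (\<lambda>n. nrm Y (R n y)) = lp_norm p k (\<lambda>n. nrm (X i) (T n (y i)))"
        using nR y by (intro lp_norm_cong) simp
      also have "\<dots> \<le> nrm (X i) (y i)"
        using X.joint_norm_bound[where T = T and k = k and x = "y i", OF p T] T1 y by simp
      also have "\<dots> \<le> 1" using nrm_coord_le[OF y(1), of i] y by simp
      finally show "lp_norm p k (\<lambda>n. nrm Y (R n y)) \<le> 1" .
    qed
    have "joint_norm p k (X i) T \<le> joint_norm p k Y R"
    proof (rule X.joint_norm_leI)
      fix x assume x: "x \<in> carrier (X i)" "nrm (X i) x = 1"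
      have "lp_norm p k (\<lambda>n. nrm (X i) (T n x)) = lp_norm p k (\<lambda>n. nrm Y (R n (single i x)))"
        using nR x by (intro lp_norm_cong) simp
      also have "\<dots> \<le> joint_norm p k Y R"
        using x by (intro Y.le_joint_norm[OF p R]) auto
      finally show "lp_norm p k (\<lambda>n. nrm (X i) (T n x)) \<le> joint_norm p k Y R" .
    qed
    then show "1 \<le> joint_norm p k Y R" using T1 by simp
  qed
  then have "joint_numerical_index p k Y \<le> joint_numerical_radius p k Y R"
    using R by (intro Y.joint_numerical_index_le[OF p]) auto
  also have "\<dots> \<le> ?w"
  proof (rule Y.joint_numerical_radius_leI)
    fix y f assume yf: "(y, f) \<in> Pi_states Y"
    then have y: "y \<in> carrier Y" "nrm Y y = 1" and f: "f \<in> dual Y"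
      and f_le: "\<And>z. z \<in> carrier Y \<Longrightarrow> norm (f z) \<le> nrm Y z"
      by (auto simp: Y_states)
    define g where "g v = f (single i v)" for v
    define b where "b = nrm (X i) (y i)"
    have g: "g \<in> dual (X i)"
      unfolding g_def
      using bounded_compose[OF XI Y normed_space_scalars single_bounded f] .
    have yi: "y i \<in> carrier (X i)" using y by simp
    have norming': "norm (g v) * b \<le> norm (g (y i)) * nrm (X i) v" if "v \<in> carrier (X i)" for v
      using norming[OF yf that] by (simp add: g_def b_def)
    have g_le_b: "norm (g (y i)) \<le> b" using f_le[of "single i (y i)"] yi by (simp add: g_def b_def)
    have b_le: "b \<le> 1" using nrm_coord_le[OF y(1), of i] y(2) by (simp add: b_def)
    have R_eq: "f (R n y) = g (T n (y i))" for n by (simp add: R_def g_def)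
    show "lp_norm p k (\<lambda>n. norm (f (R n y))) \<le> ?w"
    \<comment> \<open>If g vanishes at y i it cannot be normalised there. Then either y i = 0, which
      every T n maps to 0, or \<open>norming'\<close> makes g vanish on the whole summand.\<close>
    proof (cases "g (y i) = 0")
      case True
      have "g (T n (y i)) = 0" if n: "n < k" for n
      proof (cases "b = 0")
        case True
        then have "y i = \<zero>\<^bsub>X i\<^esub>" using X.nrm_eq_zero[OF yi] by (simp add: b_def)
        then have "T n (y i) = \<zero>\<^bsub>X i\<^esub>" using bounded_operators_zero[OF XI XI T[OF n]] by simp
        then show ?thesis using bounded_operators_zero[OF XI normed_space_scalars g] by simp
      next
        case False
        then have "0 < b" using X.nrm_nonneg[OF yi] by (simp add: b_def)
        then show ?thesis
          using norming'[OF bounded_operatorsD(1)[OF T[OF n] yi]] True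
          by (simp add: mult_le_0_iff)
      qed
      then have "lp_norm p k (\<lambda>n. norm (f (R n y))) = lp_norm p k (\<lambda>n. 0)"
        by (intro lp_norm_cong) (simp add: R_eq)
      also have "\<dots> = 0" using lp_norm_const[OF p, of 0 k] by simp
      finally show ?thesis using X.joint_numerical_radius_nonneg[where T = T and k = k, OF p T] by simp
    next
      case False
      then have c: "0 < norm (g (y i))" by simp
      then have b: "0 < b" using g_le_b by linarith
      \<comment> \<open>Here u and h are y i and g rescaled so that u has norm 1 and h u = 1; the
        bound on h is the norming hypothesis. The factors b cancel in h (T n u), which leaves f (R n
        y) = g (y i) h (T n u) with |g (y i)| \<le> 1.\<close>
      define u where "u = of_real (1 / b) \<odot>\<^bsub>X i\<^esub> y i"
      define h where "h v = of_real b / g (y i) * g v" for v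
      have nh: "norm (h v) \<le> nrm (X i) v" if "v \<in> carrier (X i)" for v
        using norming'[OF that] b c by (simp add: h_def norm_mult norm_divide field_simps)
      have hT: "h (of_real (1 / b) \<odot>\<^bsub>X i\<^esub> v) = g v / g (y i)" if "v \<in> carrier (X i)" for v
        unfolding h_def using dualD(2)[OF g that] b by simp
      have "h \<in> dual (X i)"
        using nh dualD[OF g] by (intro dualI[of _ _ 1]) (auto simp: h_def algebra_simps add_divide_distrib)
      moreover have "nrm (X i) u = 1"
        using b yi by (simp add: u_def X.nrm_smult norm_divide flip: b_def)
      ultimately have uh: "(u, h) \<in> Pi_states (X i)"
        using nh hT[OF yi] False yi by (simp add: X_states u_def)
      have "norm (f (R n y)) \<le> norm (h (T n u))" if n: "n < k" for n
      proof -
        have "h (T n u) = g (T n (y i)) / g (y i)"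
          using bounded_operatorsD[OF T[OF n]] yi hT by (simp add: u_def)
        then have "norm (f (R n y)) = norm (g (y i)) * norm (h (T n u))"
          using c by (simp add: R_eq norm_divide)
        also have "\<dots> \<le> 1 * norm (h (T n u))"
          using g_le_b b_le by (intro mult_right_mono) auto
        finally show ?thesis by simp
      qed
      then have "lp_norm p k (\<lambda>n. norm (f (R n y))) \<le> lp_norm p k (\<lambda>n. norm (h (T n u)))"
        by (intro lp_norm_mono[OF p]) auto
      also have "\<dots> \<le> ?w" by (rule X.le_joint_numerical_radius[OF p T uh])
      finally show ?thesis .
    qed
  qed
  finally show "joint_numerical_index p k Y \<le> ?w" .
qed

end

subsection \<open>Sums of l1 type\<close>

text \<open>The assumption \<open>finite_approx\<close> lets estimates on finitely many summands
  pass to the whole space.\<close>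

locale l1_type_sum = coordinate_sum X Y
  for X :: "'i \<Rightarrow> ('k::real_or_complex, 'v) nvs" and Y :: "('k, 'i \<Rightarrow> 'v) nvs" +
  assumes nrm_split: "y \<in> carrier Y \<Longrightarrow> nrm Y y = nrm (X i) (y i) + nrm Y (y(i := \<zero>\<^bsub>X i\<^esub>))"
    and finite_approx: "y \<in> carrier Y \<Longrightarrow> 0 < e \<Longrightarrow>
      \<exists>F. finite F \<and> nrm Y (\<lambda>i. if i \<in> F then \<zero>\<^bsub>X i\<^esub> else y i) < e"
begin

lemma nrm_drop: "y \<in> carrier Y \<Longrightarrow> nrm Y y = nrm (X i) (y i) + nrm Y (drop i y)"
  using nrm_split by (simp add: drop_def)

text \<open>The norms of the two parts of y add up to 1 and f is bounded by the norm on each, so f y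
  = 1 forces f to attain the norm on both. In particular its restriction to the summand norms y
  i.\<close>

lemma joint_index_le:
  assumes "0 < p" "1 \<le> k"
  shows "joint_numerical_index p k Y \<le> joint_numerical_index p k (X i)"
proof (rule joint_numerical_index_le_summand[OF _ assms])
  fix y f v assume yf: "(y, f) \<in> Pi_states Y" and v: "v \<in> carrier (X i)"
  then have y: "y \<in> carrier Y" "nrm Y y = 1" and f: "f \<in> dual Y" "f y = 1"
    and f_le: "\<And>z. z \<in> carrier Y \<Longrightarrow> norm (f z) \<le> nrm Y z"
    by (auto simp: Y_states)
  have "f (single i (y i)) + f (drop i y) = 1"
    using dualD(1)[OF f(1), of "single i (y i)" "drop i y"] y f(2) single_add_drop[OF y(1)] by simp
  then have "1 \<le> norm (f (single i (y i))) + norm (f (drop i y))"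
    using norm_triangle_ineq[of "f (single i (y i))" "f (drop i y)"] by simp
  then have "nrm (X i) (y i) \<le> norm (f (single i (y i)))"
    using f_le[of "drop i y"] nrm_drop[OF y(1), of i] y by simp
  then have "nrm (X i) v * nrm (X i) (y i) \<le> nrm (X i) v * norm (f (single i (y i)))"
    using v by (intro mult_left_mono) auto
  moreover have "norm (f (single i v)) * nrm (X i) (y i) \<le> nrm (X i) v * nrm (X i) (y i)"
    using f_le[of "single i v"] v y by (intro mult_right_mono) auto
  ultimately show "norm (f (single i v)) * nrm (X i) (y i) \<le> norm (f (single i (y i))) * nrm (X i) v"
    by (simp add: mult.commute)
qed

text \<open>The part of \<open>T\<close> that leaves the summand is folded back into it by a rank one operator whose
  functional norms that part at \<open>x\<close>.\<close>

lemma numerical_index_mult_single_le: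
  assumes T: "T \<in> bounded_operators Y Y" and x: "x \<in> carrier (X i)" "nrm (X i) x \<le> 1"
  shows "numerical_index (X i) * nrm Y (T (single i x)) \<le> numerical_radius Y T"
proof -
  note XI = X.normed_space_axioms[of i]
  have TJ: "(\<lambda>z. T (single i z)) \<in> bounded_operators (X i) Y"
    by (rule bounded_compose[OF XI Y Y single_bounded T])
  note TJc = bounded_operatorsD(1)[OF TJ]
  let ?v = "T (single i x)"
  have v: "?v \<in> carrier Y" using TJc x by simp
  have vi: "?v i \<in> carrier (X i)" using v by simp
  obtain a where a: "a \<in> carrier (X i)" "nrm (X i) a = 1" "?v i = of_real (nrm (X i) (?v i)) \<odot>\<^bsub>X i\<^esub> a"
    by (rule X.exists_unit_direction[OF vi X.nontrivial])
  obtain h where h: "h \<in> dual Y" "\<And>z. z \<in> carrier Y \<Longrightarrow> norm (h z) \<le> nrm Y z"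
    "h (drop i ?v) = of_real (nrm Y (drop i ?v))"
    by (rule Y.exists_norming_functional[OF drop_carrier[OF v, of i]]) blast
  have hd: "(\<lambda>z. h (drop i z)) \<in> dual Y"
    by (rule bounded_compose[OF Y Y normed_space_scalars drop_bounded h(1)])
  \<comment> \<open>At x both terms are multiples of the same unit vector a, with the norms of the
    two parts of T (single i x) as factors. On an l1 type sum these add, so no norm is lost.\<close>
  define S where "S z = T (single i z) i \<oplus>\<^bsub>X i\<^esub> h (drop i (T (single i z))) \<odot>\<^bsub>X i\<^esub> a" for z
  have S: "S \<in> bounded_operators (X i) (X i)"
    unfolding S_def
    by (intro bounded_add[OF XI XI] bounded_rank_one[OF XI XI] a
        bounded_compose[OF XI Y XI TJ coord_bounded] bounded_compose[OF XI Y normed_space_scalars TJ hd])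
  have "S x = of_real (nrm Y ?v) \<odot>\<^bsub>X i\<^esub> a"
    using a(1) by (simp add: S_def h(3) nrm_drop[OF v, of i] X.smult_add_left flip: a(3))
  then have Sx: "nrm (X i) (S x) = nrm Y ?v" using a(1,2) v by (simp add: X.nrm_smult)
  have "numerical_index (X i) * nrm (X i) (S x) \<le> numerical_radius Y T"
  proof (rule X.numerical_index_mult_nrm_le[OF S x])
    fix u f assume uf: "(u, f) \<in> Pi_states (X i)"
    then have u: "u \<in> carrier (X i)" "nrm (X i) u = 1" and f: "f \<in> dual (X i)" "f u = 1"
      and f_le: "\<And>z. z \<in> carrier (X i) \<Longrightarrow> norm (f z) \<le> nrm (X i) z"
      by (auto simp: X_states)
    \<comment> \<open>Chosen so that f (S u) = G (T (single i u)). A functional on an l1 splitting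
      has as its norm the larger of its norms on the two parts, and both are at most 1 here.\<close>
    define G where "G y = f (y i) + f a * h (drop i y)" for y
    have G_le: "norm (G y) \<le> nrm Y y" if y: "y \<in> carrier Y" for y
    proof -
      have "norm (f a * h (drop i y)) \<le> 1 * nrm Y (drop i y)"
        unfolding norm_mult using f_le[OF a(1)] a(2) h(2) y by (intro mult_mono) auto
      then show ?thesis
        unfolding G_def nrm_drop[OF y, of i] using f_le[of "y i"] y by (intro norm_triangle_le) simp
    qed
    have "G \<in> dual Y"
      using G_le by (intro dualI[of _ _ 1])
        (auto simp: G_def algebra_simps dualD[OF hd] bounded_operatorsD[OF coord_bounded]
          dualD[OF f(1)])
    moreover have "G (single i u) = 1"
      using bounded_operators_zero[OF Y normed_space_scalars h(1)] f(2) by (simp add: G_def)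
    ultimately have "(single i u, G) \<in> Pi_states Y"
      using u G_le by (simp add: Y_states)
    then have "norm (G (T (single i u))) \<le> numerical_radius Y T"
      by (rule Y.le_numerical_radius[OF T])
    moreover have "f (S u) = G (T (single i u))"
      using TJc[OF u(1)] a(1) by (simp add: S_def G_def dualD[OF f(1)] mult.commute)
    ultimately show "norm (f (S u)) \<le> numerical_radius Y T" by simp
  qed
  then show ?thesis by (simp add: Sx)
qed

text \<open>The locale splits off only one coordinate at a time, so finite truncations go by
  induction. Membership of both truncations is carried along because the triangle inequality and the
  next splitting require it.\<close>

lemma restrict_finite:
  assumes y: "y \<in> carrier Y" and "finite F"
  shows "(\<lambda>i. if i \<in> F then y i else \<zero>\<^bsub>X i\<^esub>) \<in> carrier Y \<and>
    (\<forall>T. T \<in> bounded_operators Y Y \<longrightarrow>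
      nrm Y (T (\<lambda>i. if i \<in> F then y i else \<zero>\<^bsub>X i\<^esub>)) \<le> (\<Sum>i\<in>F. nrm Y (T (single i (y i))))) \<and>
    (\<Sum>i\<in>F. nrm (X i) (y i)) + nrm Y (\<lambda>i. if i \<in> F then \<zero>\<^bsub>X i\<^esub> else y i) = nrm Y y \<and>
    (\<lambda>i. if i \<in> F then \<zero>\<^bsub>X i\<^esub> else y i) \<in> carrier Y"
  using assms(2)
proof induction
  case empty
  then show ?case using y Y.zero_closed bounded_operators_zero[OF Y Y] by (simp flip: zero_Y)
next
  case (insert j F)
  let ?r = "\<lambda>F i. if i \<in> F then y i else \<zero>\<^bsub>X i\<^esub>" and ?d = "\<lambda>F i. if i \<in> F then \<zero>\<^bsub>X i\<^esub> else y i"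
  have r: "?r F \<in> carrier Y" and d: "?d F \<in> carrier Y" using insert.IH by auto
  have sj: "single j (y j) \<in> carrier Y" using y by simp
  have eq: "?r (insert j F) = single j (y j) \<oplus>\<^bsub>Y\<^esub> ?r F"
    using insert.hyps y by (auto simp: add_Y single_def fun_eq_iff)
  have d_eq: "?d (insert j F) = drop j (?d F)"
    by (auto simp: drop_def fun_eq_iff)
  have "nrm Y (T (?r (insert j F))) \<le> (\<Sum>i\<in>insert j F. nrm Y (T (single i (y i))))"
    if T: "T \<in> bounded_operators Y Y" for T
  proof -
    have "nrm Y (T (?r (insert j F))) \<le> nrm Y (T (single j (y j))) + nrm Y (T (?r F))"
      unfolding eq using bounded_operatorsD[OF T] sj r by (simp add: Y.nrm_triangle)
    moreover have "nrm Y (T (?r F)) \<le> (\<Sum>i\<in>F. nrm Y (T (single i (y i))))"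
      using insert.IH T by blast
    ultimately show ?thesis using insert.hyps by simp
  qed
  moreover have "nrm Y (?d F) = nrm (X j) (y j) + nrm Y (?d (insert j F))"
    using nrm_drop[OF d, of j] insert.hyps unfolding d_eq by simp
  moreover have "?r (insert j F) \<in> carrier Y" unfolding eq using sj r by simp
  moreover have "?d (insert j F) \<in> carrier Y" unfolding d_eq using d by simp
  moreover have "(\<Sum>i\<in>F. nrm (X i) (y i)) + nrm Y (?d F) = nrm Y y" using insert.IH by blast
  ultimately show ?case using insert.hyps by simp
qed

text \<open>An operator on an l1 type sum is no larger than its restrictions to the summands: the
  bound on single summands extends to finitely supported vectors by additivity of the norm, and to
  all vectors by approximation.\<close>

lemma index_ge:
  assumes m: "0 \<le> m" "\<And>i. m \<le> numerical_index (X i)"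
  shows "m \<le> numerical_index Y"
proof (rule Y.le_numerical_index)
  fix T assume T: "T \<in> bounded_operators Y Y" and T1: "op_norm Y Y T = 1"
  let ?w = "numerical_radius Y T"
  have w0: "0 \<le> ?w" by (rule Y.numerical_radius_nonneg[OF T])
  have single_le: "m * nrm Y (T (single i x)) \<le> ?w * nrm (X i) x" if x: "x \<in> carrier (X i)" for i x
  proof -
    obtain u where u: "u \<in> carrier (X i)" "nrm (X i) u = 1" "x = of_real (nrm (X i) x) \<odot>\<^bsub>X i\<^esub> u"
      by (rule X.exists_unit_direction[OF x X.nontrivial])
    have Tu: "T (single i u) \<in> carrier Y" using bounded_operatorsD(1)[OF T] u by simp
    have "T (single i x) = of_real (nrm (X i) x) \<odot>\<^bsub>Y\<^esub> T (single i u)"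
      using bounded_operatorsD(3)[OF bounded_compose[OF X.normed_space_axioms Y Y single_bounded T] u(1),
          of "of_real (nrm (X i) x)"]
      by (simp flip: u(3))
    then have "nrm Y (T (single i x)) = nrm (X i) x * nrm Y (T (single i u))"
      using x Tu by (simp add: Y.nrm_smult)
    moreover have "m * nrm Y (T (single i u)) \<le> numerical_index (X i) * nrm Y (T (single i u))"
      using m(2) Tu by (intro mult_right_mono) auto
    then have "m * nrm Y (T (single i u)) \<le> ?w"
      using numerical_index_mult_single_le[OF T u(1)] u(2) by simp
    ultimately show ?thesis using mult_left_mono[of "m * nrm Y (T (single i u))" ?w "nrm (X i) x"] x
      by (simp add: mult_ac)
  qed
  have le: "m * nrm Y (T y) \<le> ?w" if y: "y \<in> carrier Y" "nrm Y y \<le> 1" for y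
  proof (rule field_le_epsilon)
    fix e :: real assume e: "0 < e"
    \<comment> \<open>The discarded tail contributes at most m * d, which has to stay below e; the
      added 1 guards against m = 0.\<close>
    define d where "d = e / (m + 1)"
    have d: "0 < d" "m * d \<le> e" using e m(1) by (auto simp: d_def field_simps)
    obtain F where F: "finite F" "nrm Y (\<lambda>i. if i \<in> F then \<zero>\<^bsub>X i\<^esub> else y i) < d"
      using finite_approx[OF y(1) d(1)] by blast
    let ?r = "\<lambda>i. if i \<in> F then y i else \<zero>\<^bsub>X i\<^esub>" and ?d = "\<lambda>i. if i \<in> F then \<zero>\<^bsub>X i\<^esub> else y i"
    note rf = restrict_finite[OF y(1) F(1)]
    have r: "?r \<in> carrier Y" and dc: "?d \<in> carrier Y" using rf by auto
    have "?r \<oplus>\<^bsub>Y\<^esub> ?d = y" using y by (auto simp: add_Y fun_eq_iff)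
    then have "T y = T ?r \<oplus>\<^bsub>Y\<^esub> T ?d" using bounded_operatorsD(2)[OF T r dc] by simp
    then have "nrm Y (T y) \<le> nrm Y (T ?r) + nrm Y (T ?d)"
      using Y.nrm_triangle[OF bounded_operatorsD(1)[OF T r] bounded_operatorsD(1)[OF T dc]] by simp
    moreover have "nrm Y (T ?d) \<le> d" using op_norm_bound[OF Y Y T dc] T1 F(2) by simp
    moreover have "nrm Y (T ?r) \<le> (\<Sum>i\<in>F. nrm Y (T (single i (y i))))" using rf T by blast
    ultimately have "m * nrm Y (T y) \<le> m * ((\<Sum>i\<in>F. nrm Y (T (single i (y i)))) + d)"
      using m(1) by (intro mult_left_mono) auto
    also have "\<dots> = (\<Sum>i\<in>F. m * nrm Y (T (single i (y i)))) + m * d"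
      by (simp add: algebra_simps sum_distrib_left)
    also have "\<dots> \<le> (\<Sum>i\<in>F. ?w * nrm (X i) (y i)) + e"
      using single_le y d(2) by (intro add_mono sum_mono) auto
    also have "\<dots> \<le> ?w * nrm Y y + e"
    proof -
      have "(\<Sum>i\<in>F. nrm (X i) (y i)) \<le> nrm Y y" using rf Y.nrm_nonneg[OF dc] by linarith
      then have "?w * (\<Sum>i\<in>F. nrm (X i) (y i)) \<le> ?w * nrm Y y" by (intro mult_left_mono w0)
      then show ?thesis by (simp add: sum_distrib_left)
    qed
    also have "\<dots> \<le> ?w + e" using mult_left_mono[OF y(2) w0] by simp
    finally show "m * nrm Y (T y) \<le> ?w + e" .
  qed
  show "m \<le> ?w"
  proof (cases "m = 0")
    case False
    then have "op_norm Y Y T \<le> ?w / m"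
      using le m(1) by (intro op_norm_leI[OF Y]) (simp add: field_simps)
    then show ?thesis using T1 False m(1) by (simp add: field_simps)
  qed (use w0 in simp)
qed

end

subsection \<open>Sums of supremum type\<close>

text \<open>Serves both the l_infinity and the c_0 sum: the value of an operator is estimated
  coordinate by coordinate, and \<open>nrm_leI\<close> collects the estimates.\<close>

locale sup_type_sum = coordinate_sum X Y
  for X :: "'i \<Rightarrow> ('k::real_or_complex, 'v) nvs" and Y :: "('k, 'i \<Rightarrow> 'v) nvs" +
  assumes nrm_split: "y \<in> carrier Y \<Longrightarrow> nrm Y y = max (nrm (X i) (y i)) (nrm Y (y(i := \<zero>\<^bsub>X i\<^esub>)))"
    and nrm_leI: "y \<in> carrier Y \<Longrightarrow> (\<And>i. nrm (X i) (y i) \<le> c) \<Longrightarrow> nrm Y y \<le> c"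
begin

lemma nrm_drop: "y \<in> carrier Y \<Longrightarrow> nrm Y y = max (nrm (X i) (y i)) (nrm Y (drop i y))"
  using nrm_split by (simp add: drop_def)

lemma nrm_replace:
  assumes "y \<in> carrier Y" "v \<in> carrier (X i)"
  shows "nrm Y (single i v \<oplus>\<^bsub>Y\<^esub> a \<odot>\<^bsub>Y\<^esub> drop i y) = max (nrm (X i) v) (norm a * nrm Y (drop i y))"
proof -
  have "(a \<odot>\<^bsub>Y\<^esub> drop i y) i = \<zero>\<^bsub>X i\<^esub>" by (simp add: smult_Y)
  then show ?thesis
    using assms by (subst nrm_drop[of _ i]) (simp_all add: single_add_coord drop_single_add Y.nrm_smult)
qed

text \<open>Replacing y i by a rotated unit vector u keeps the norm at most 1, so f cannot gain: |f
  (single i u)| is at most |f (single i (y i))|. Hence the restriction of f attains its norm at y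
  i.\<close>

lemma joint_index_le:
  assumes "0 < p" "1 \<le> k"
  shows "joint_numerical_index p k Y \<le> joint_numerical_index p k (X i)"
proof (rule joint_numerical_index_le_summand[OF _ assms])
  fix y f v assume yf: "(y, f) \<in> Pi_states Y" and v: "v \<in> carrier (X i)"
  then have y: "y \<in> carrier Y" "nrm Y y = 1" and f: "f \<in> dual Y" "f y = 1"
    and f_le: "\<And>z. z \<in> carrier Y \<Longrightarrow> norm (f z) \<le> nrm Y z"
    by (auto simp: Y_states)
  have sum1: "f (single i (y i)) + f (drop i y) = 1"
    using dualD(1)[OF f(1), of "single i (y i)" "drop i y"] y f(2) single_add_drop[OF y(1)] by simp
  obtain u where u: "u \<in> carrier (X i)" "nrm (X i) u = 1" "v = of_real (nrm (X i) v) \<odot>\<^bsub>X i\<^esub> u"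
    by (rule X.exists_unit_direction[OF v X.nontrivial])
  \<comment> \<open>After this rotation f is real and nonnegative on the new part, so that adding 1
    to it causes no cancellation.\<close>
  obtain a :: 'k where a: "norm a = 1" "a * f (single i u) = of_real (norm (f (single i u)))"
    by (rule exists_unimodular_factor)
  let ?z = "single i (a \<odot>\<^bsub>X i\<^esub> u) \<oplus>\<^bsub>Y\<^esub> 1 \<odot>\<^bsub>Y\<^esub> drop i y"
  have "nrm Y ?z \<le> 1"
    using nrm_replace[OF y(1), of "a \<odot>\<^bsub>X i\<^esub> u" i 1] nrm_drop[OF y(1), of i] y(2) u(1,2) a(1)
    by (simp add: X.nrm_smult)
  then have "norm (f ?z) \<le> 1" using f_le[of ?z] u(1) y by simp
  moreover have "f ?z = of_real (norm (f (single i u))) + (1 - f (single i (y i)))"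
    using sum1 a(2) u(1) y bounded_operatorsD(3)[OF single_bounded u(1), of a]
    by (simp add: dualD[OF f(1)] algebra_simps)
  then have "of_real (norm (f (single i u)) + 1) = f ?z + f (single i (y i))" by simp
  then have "norm (f (single i u)) + 1 \<le> norm (f ?z) + norm (f (single i (y i)))"
    using norm_triangle_ineq[of "f ?z" "f (single i (y i))"] norm_of_real[where 'a = 'k, of "norm (f (single i u)) + 1"]
    by (simp only: abs_of_nonneg add_nonneg_nonneg norm_ge_zero zero_le_one)
  ultimately have le: "norm (f (single i u)) \<le> norm (f (single i (y i)))" by simp
  have "f (single i v) = of_real (nrm (X i) v) * f (single i u)"
    using dualD(2)[OF bounded_compose[OF X.normed_space_axioms Y normed_space_scalars single_bounded f(1)] u(1),
        of "of_real (nrm (X i) v)"]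
    by (simp flip: u(3))
  then have "norm (f (single i v)) * nrm (X i) (y i)
      = nrm (X i) v * (norm (f (single i u)) * nrm (X i) (y i))"
    using v by (simp add: norm_mult)
  also have "\<dots> \<le> nrm (X i) v * (norm (f (single i (y i))) * 1)"
    using le nrm_coord_le[OF y(1), of i] y v by (intro mult_left_mono mult_mono) auto
  finally show "norm (f (single i v)) * nrm (X i) (y i) \<le> norm (f (single i (y i))) * nrm (X i) v"
    by (simp add: mult.commute)
qed

text \<open>The influence on the \<open>i\<close>-th coordinate of \<open>T y\<close> of the coordinates of \<open>y\<close> outside \<open>i\<close> is
  transferred to the summand by a rank one operator built from a functional that norms \<open>y i\<close>.\<close>

lemma numerical_index_mult_coord_le_unit:
  assumes T: "T \<in> bounded_operators Y Y" and y: "y \<in> carrier Y" "nrm Y y \<le> 1"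
    and yi: "nrm (X i) (y i) = 1"
  shows "numerical_index (X i) * nrm (X i) (T y i) \<le> numerical_radius Y T"
proof -
  note XI = X.normed_space_axioms[of i]
  obtain g where g: "g \<in> dual (X i)" "\<And>z. z \<in> carrier (X i) \<Longrightarrow> norm (g z) \<le> nrm (X i) z"
    "g (y i) = 1"
    using X.exists_norming_functional[of "y i" i] y yi by auto
  \<comment> \<open>E maps y i to y because g (y i) = 1, and it preserves norms because |g z| times
    the norm of the rest of y is at most that of z. A state (u, f) of the summand thus lifts to the
    vector E u with f applied to coordinate i.\<close>
  define E where "E z = single i z \<oplus>\<^bsub>Y\<^esub> g z \<odot>\<^bsub>Y\<^esub> drop i y" for z
  have E: "E \<in> bounded_operators (X i) Y"
    unfolding E_def using y
    by (intro bounded_add[OF XI Y] bounded_rank_one[OF XI Y] single_bounded g) auto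
  have S: "(\<lambda>z. T (E z) i) \<in> bounded_operators (X i) (X i)"
    by (rule bounded_compose[OF XI Y XI bounded_compose[OF XI Y Y E T] coord_bounded])
  have Ey: "E (y i) = y" using y by (simp add: E_def g(3) single_add_drop)
  have "numerical_index (X i) * nrm (X i) (T (E (y i)) i) \<le> numerical_radius Y T"
  proof (rule X.numerical_index_mult_nrm_le[OF S])
    fix u f assume uf: "(u, f) \<in> Pi_states (X i)"
    then have u: "u \<in> carrier (X i)" "nrm (X i) u = 1" and f: "f \<in> dual (X i)" "f u = 1"
      and f_le: "\<And>z. z \<in> carrier (X i) \<Longrightarrow> norm (f z) \<le> nrm (X i) z"
      by (auto simp: X_states)
    have Eu: "E u \<in> carrier Y" by (rule bounded_operatorsD(1)[OF E u(1)])
    have "norm (g u) * nrm Y (drop i y) \<le> 1 * 1"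
      using g(2)[OF u(1)] u(2) nrm_drop[OF y(1), of i] y by (intro mult_mono) auto
    then have "nrm Y (E u) = 1"
      unfolding E_def nrm_replace[OF y(1) u(1)] using u(2) by simp
    moreover have "(\<lambda>z. f (z i)) \<in> dual Y"
      by (rule bounded_compose[OF Y XI normed_space_scalars coord_bounded f(1)])
    moreover have "norm (f (z i)) \<le> nrm Y z" if "z \<in> carrier Y" for z
      using f_le[of "z i"] nrm_coord_le[OF that, of i] that by simp
    moreover have "E u i = u"
      unfolding E_def using u(1) by (intro single_add_coord) (auto simp: smult_Y)
    ultimately have "(E u, \<lambda>z. f (z i)) \<in> Pi_states Y"
      using Eu f(2) by (simp add: Y_states)
    then show "norm (f (T (E u) i)) \<le> numerical_radius Y T"
      by (rule Y.le_numerical_radius[OF T])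
  qed (use y yi in auto)
  then show ?thesis by (simp add: Ey)
qed

text \<open>A vector of norm at most 1 lies on a segment between two points of the unit sphere, so the
  coordinate \<open>y i\<close> may be assumed to have norm 1.\<close>

lemma numerical_index_mult_coord_le:
  assumes T: "T \<in> bounded_operators Y Y" and y: "y \<in> carrier Y" "nrm Y y \<le> 1"
  shows "numerical_index (X i) * nrm (X i) (T y i) \<le> numerical_radius Y T"
proof -
  let ?n = "numerical_index (X i)" and ?w = "numerical_radius Y T"
  define r where "r = nrm (X i) (y i)"
  have r: "0 \<le> r" "r \<le> 1" using nrm_coord_le[OF y(1), of i] y by (auto simp: r_def)
  obtain u where u: "u \<in> carrier (X i)" "nrm (X i) u = 1" "y i = of_real r \<odot>\<^bsub>X i\<^esub> u"
    unfolding r_def by (rule X.exists_unit_direction[OF coord_carrier[OF y(1)] X.nontrivial])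
  define E where "E a = single i (a \<odot>\<^bsub>X i\<^esub> u) \<oplus>\<^bsub>Y\<^esub> 1 \<odot>\<^bsub>Y\<^esub> drop i y" for a
  have Ec: "E a \<in> carrier Y" for a using u y by (simp add: E_def)
  have TE: "T (E a) i \<in> carrier (X i)" for a using bounded_operatorsD(1)[OF T Ec] by simp
  have bound: "?n * nrm (X i) (T (E a) i) \<le> ?w" if a: "norm a = 1" for a
  proof (rule numerical_index_mult_coord_le_unit[OF T Ec])
    show "nrm Y (E a) \<le> 1"
      unfolding E_def using nrm_replace[OF y(1), of "a \<odot>\<^bsub>X i\<^esub> u" i 1] nrm_drop[OF y(1), of i] y(2) u a
      by (simp add: X.nrm_smult)
    have "E a i = a \<odot>\<^bsub>X i\<^esub> u"
      unfolding E_def using u(1) by (intro single_add_coord) (auto simp: smult_Y)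
    then show "nrm (X i) (E a i) = 1" using u a by (simp add: X.nrm_smult)
  qed
  \<comment> \<open>The weights solve s + t = 1 and s - t = r, so y is the convex combination of E
    1, with u at coordinate i, and E (- 1), with -u there; elsewhere both agree with y.\<close>
  define s t where "s = (of_real ((1 + r) / 2) :: 'k)" and "t = (of_real ((1 - r) / 2) :: 'k)"
  have "s + t = of_real ((1 + r) / 2 + (1 - r) / 2)" "s - t = of_real ((1 + r) / 2 - (1 - r) / 2)"
    by (simp_all only: s_def t_def of_real_add of_real_diff)
  moreover have "(1 + r) / 2 + (1 - r) / 2 = 1" "(1 + r) / 2 - (1 - r) / 2 = r"
    by (simp_all add: field_simps)
  ultimately have st: "s + t = 1" "s - t = of_real r" by simp_all
  have "s \<odot>\<^bsub>Y\<^esub> E 1 \<oplus>\<^bsub>Y\<^esub> t \<odot>\<^bsub>Y\<^esub> E (- 1) = y"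
  proof
    fix j
    show "(s \<odot>\<^bsub>Y\<^esub> E 1 \<oplus>\<^bsub>Y\<^esub> t \<odot>\<^bsub>Y\<^esub> E (- 1)) j = y j"
    proof (cases "j = i")
      case True
      have "s \<odot>\<^bsub>X i\<^esub> u \<oplus>\<^bsub>X i\<^esub> (- t) \<odot>\<^bsub>X i\<^esub> u = y i"
        using u(1) st(2) by (simp add: u(3) flip: X.smult_add_left)
      then show ?thesis using True u(1)
        by (simp add: E_def add_Y smult_Y X.smult_smult)
    next
      case False
      then have "s \<odot>\<^bsub>X j\<^esub> y j \<oplus>\<^bsub>X j\<^esub> t \<odot>\<^bsub>X j\<^esub> y j = y j"
        using y st(1) by (simp flip: X.smult_add_left)
      then show ?thesis using False y by (simp add: E_def add_Y smult_Y single_def drop_def)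
    qed
  qed
  then have "T y = s \<odot>\<^bsub>Y\<^esub> T (E 1) \<oplus>\<^bsub>Y\<^esub> t \<odot>\<^bsub>Y\<^esub> T (E (- 1))"
    using bounded_operatorsD(2)[OF T, of "s \<odot>\<^bsub>Y\<^esub> E 1" "t \<odot>\<^bsub>Y\<^esub> E (- 1)"] bounded_operatorsD(3)[OF T Ec] Ec
    by simp
  then have "T y i = s \<odot>\<^bsub>X i\<^esub> T (E 1) i \<oplus>\<^bsub>X i\<^esub> t \<odot>\<^bsub>X i\<^esub> T (E (- 1)) i"
    by (simp add: add_Y smult_Y)
  then have "nrm (X i) (T y i) \<le> norm s * nrm (X i) (T (E 1) i) + norm t * nrm (X i) (T (E (- 1)) i)"
    using X.nrm_triangle[of "s \<odot>\<^bsub>X i\<^esub> T (E 1) i" i "t \<odot>\<^bsub>X i\<^esub> T (E (- 1)) i"] TE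
    by (simp add: X.nrm_smult)
  also have "norm s = (1 + r) / 2" using r unfolding s_def norm_of_real by simp
  also have "norm t = (1 - r) / 2" using r unfolding t_def norm_of_real by simp
  finally have "?n * nrm (X i) (T y i)
      \<le> ?n * ((1 + r) / 2 * nrm (X i) (T (E 1) i) + (1 - r) / 2 * nrm (X i) (T (E (- 1)) i))"
    by (intro mult_left_mono X.numerical_index_nonneg)
  also have "\<dots> = (1 + r) / 2 * (?n * nrm (X i) (T (E 1) i)) + (1 - r) / 2 * (?n * nrm (X i) (T (E (- 1)) i))"
    by (simp only: distrib_left mult.left_commute)
  also have "\<dots> \<le> (1 + r) / 2 * ?w + (1 - r) / 2 * ?w"
    using bound[of 1] bound[of "- 1"] r by (intro add_mono mult_left_mono) auto
  also have "\<dots> = ?w" by (simp add: field_simps)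
  finally show ?thesis .
qed

lemma index_ge:
  assumes m: "0 \<le> m" "\<And>i. m \<le> numerical_index (X i)"
  shows "m \<le> numerical_index Y"
proof (rule Y.le_numerical_index)
  fix T assume T: "T \<in> bounded_operators Y Y" and T1: "op_norm Y Y T = 1"
  let ?w = "numerical_radius Y T"
  show "m \<le> ?w"
  proof (cases "m = 0")
    case True
    then show ?thesis using Y.numerical_radius_nonneg[OF T] by simp
  next
    case False
    then have m0: "0 < m" using m(1) by simp
    have "op_norm Y Y T \<le> ?w / m"
    proof (rule op_norm_leI[OF Y])
      fix y assume y: "y \<in> carrier Y" "nrm Y y \<le> 1"
      have Ty: "T y \<in> carrier Y" by (rule bounded_operatorsD(1)[OF T y(1)])
      show "nrm Y (T y) \<le> ?w / m"
      proof (rule nrm_leI[OF Ty])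
        fix i
        have "m * nrm (X i) (T y i) \<le> numerical_index (X i) * nrm (X i) (T y i)"
          using m(2) Ty by (intro mult_right_mono) auto
        then show "nrm (X i) (T y i) \<le> ?w / m"
          using numerical_index_mult_coord_le[OF T y, of i] m0 by (simp add: field_simps)
      qed
    qed
    then show ?thesis using T1 m0 by (simp add: field_simps)
  qed
qed

end

subsection \<open>The three sums\<close>

lemma sum_structure_simps [simp]:
  "carrier (sum_structure X C N) = C" "nrm (sum_structure X C N) = N"
  "\<zero>\<^bsub>sum_structure X C N\<^esub> = (\<lambda>i. \<zero>\<^bsub>X i\<^esub>)"
  "x \<oplus>\<^bsub>sum_structure X C N\<^esub> y = (\<lambda>i. x i \<oplus>\<^bsub>X i\<^esub> y i)"
  "a \<odot>\<^bsub>sum_structure X C N\<^esub> y = (\<lambda>i. a \<odot>\<^bsub>X i\<^esub> y i)"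
  by (simp_all add: sum_structure_def)

lemma normed_space_sum_structure:
  fixes X :: "'i \<Rightarrow> ('k::real_or_complex, 'v) nvs"
  assumes X: "\<And>i. normed_space (X i)"
    and coord: "\<And>x i. x \<in> C \<Longrightarrow> x i \<in> carrier (X i)"
    and zero: "(\<lambda>i. \<zero>\<^bsub>X i\<^esub>) \<in> C"
    and add: "\<And>x y. x \<in> C \<Longrightarrow> y \<in> C \<Longrightarrow> (\<lambda>i. x i \<oplus>\<^bsub>X i\<^esub> y i) \<in> C"
    and smult: "\<And>a x. x \<in> C \<Longrightarrow> (\<lambda>i. a \<odot>\<^bsub>X i\<^esub> x i) \<in> C"
    and N_zero: "N (\<lambda>i. \<zero>\<^bsub>X i\<^esub>) = 0"
    and N_zeroD: "\<And>x i. x \<in> C \<Longrightarrow> N x = 0 \<Longrightarrow> nrm (X i) (x i) = 0"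
    and N_triangle: "\<And>x y. x \<in> C \<Longrightarrow> y \<in> C \<Longrightarrow> N (\<lambda>i. x i \<oplus>\<^bsub>X i\<^esub> y i) \<le> N x + N y"
    and N_smult: "\<And>a x. x \<in> C \<Longrightarrow> N (\<lambda>i. a \<odot>\<^bsub>X i\<^esub> x i) = norm a * N x"
  shows "normed_space (sum_structure X C N)"
proof -
  interpret X: normed_space "X i" for i by (rule X)
  let ?Y = "sum_structure X C N"
  have "abelian_group ?Y"
  proof (rule abelian_groupI)
    \<comment> \<open>The record has no negation; inverses come from multiplication by -1.\<close>
    fix x assume x: "x \<in> carrier ?Y"
    then show "\<exists>y\<in>carrier ?Y. y \<oplus>\<^bsub>?Y\<^esub> x = \<zero>\<^bsub>?Y\<^esub>"
      using smult[of x "- 1"] coord[of x]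
      by (intro bexI[of _ "\<lambda>i. (- 1) \<odot>\<^bsub>X i\<^esub> x i"]) (auto simp: X.a_comm[of _ _ "x _"])
  qed (use coord zero add in \<open>auto simp: X.a_ac\<close>)
  then have "module scalars ?Y"
    using coord smult
    by (intro moduleI cring_scalars)
      (auto simp: X.smult_add_left X.smult_add_right X.smult_smult)
  then show ?thesis
  proof (intro normed_space.intro normed_space_axioms.intro)
    fix x assume "x \<in> carrier ?Y"
    then have x: "x \<in> C" by simp
    have "x = (\<lambda>i. \<zero>\<^bsub>X i\<^esub>)" if "N x = 0"
      using N_zeroD[OF x that] X.nrm_eq_zero[OF coord[OF x]] by auto
    then show "nrm ?Y x = 0 \<longleftrightarrow> x = \<zero>\<^bsub>?Y\<^esub>" using N_zero by auto
  qed (use N_triangle N_smult in auto)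
qed

text \<open>The l_infinity and c_0 sums differ only in their carriers, so everything beyond closure
  and boundedness of the carrier is proved once.\<close>

lemma sup_type_sumI:
  fixes X :: "'i \<Rightarrow> ('k::real_or_complex, 'v) nvs"
  assumes X: "\<And>i. nontrivial_normed_space (X i)"
    and coord: "\<And>x i. x \<in> C \<Longrightarrow> x i \<in> carrier (X i)"
    and add: "\<And>x y. x \<in> C \<Longrightarrow> y \<in> C \<Longrightarrow> (\<lambda>i. x i \<oplus>\<^bsub>X i\<^esub> y i) \<in> C"
    and smult: "\<And>a x. x \<in> C \<Longrightarrow> (\<lambda>i. a \<odot>\<^bsub>X i\<^esub> x i) \<in> C"
    and single: "\<And>i v. v \<in> carrier (X i) \<Longrightarrow> (\<lambda>j. if j = i then v else \<zero>\<^bsub>X j\<^esub>) \<in> C"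
    and bdd: "\<And>x. x \<in> C \<Longrightarrow> bdd_above (range (\<lambda>i. nrm (X i) (x i)))"
  shows "sup_type_sum X (sum_structure X C (\<lambda>x. SUP i. nrm (X i) (x i)))"
proof -
  interpret X: nontrivial_normed_space "X i" for i by (rule X)
  let ?N = "\<lambda>x. SUP i. nrm (X i) (x i)"
  let ?Y = "sum_structure X C ?N"
  have upper: "nrm (X i) (x i) \<le> ?N x" if "x \<in> C" for x i
    by (rule cSUP_upper[OF UNIV_I bdd[OF that]])
  have least: "?N x \<le> c" if "\<And>i. nrm (X i) (x i) \<le> c" for x c
    using that by (intro cSUP_least) auto
  have "(\<lambda>j. if j = i then \<zero>\<^bsub>X i\<^esub> else \<zero>\<^bsub>X j\<^esub>) = (\<lambda>j. \<zero>\<^bsub>X j\<^esub>)" for i by auto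
  \<comment> \<open>Zero is the vector with the single entry 0 at an arbitrary index;
    \<open>undefined\<close> is one, the index set being a type.\<close>
  then have zero: "(\<lambda>i. \<zero>\<^bsub>X i\<^esub>) \<in> C" using single[OF X.zero_closed, of undefined] by simp
  have N_nonneg: "0 \<le> ?N x" if "x \<in> C" for x
    using upper[OF that, of undefined] X.nrm_nonneg[OF coord[OF that], of undefined] by simp
  have Y: "normed_space ?Y"
  proof (rule normed_space_sum_structure)
    fix x i assume "x \<in> C" "?N x = 0"
    then show "nrm (X i) (x i) = 0"
      using upper[of x i] X.nrm_nonneg[OF coord, of x i] by simp
  next
    fix x y assume xy: "x \<in> C" "y \<in> C"
    show "?N (\<lambda>i. x i \<oplus>\<^bsub>X i\<^esub> y i) \<le> ?N x + ?N y"
    proof (rule least)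
      fix i
      show "nrm (X i) (x i \<oplus>\<^bsub>X i\<^esub> y i) \<le> ?N x + ?N y"
        using X.nrm_triangle[OF coord[OF xy(1)] coord[OF xy(2)], of i] upper[OF xy(1), of i]
          upper[OF xy(2), of i] by simp
    qed
  next
    fix a and x assume x: "x \<in> C"
    have le: "?N (\<lambda>i. a \<odot>\<^bsub>X i\<^esub> x i) \<le> norm a * ?N x" if "x \<in> C" for a x
      using upper[OF that] coord[OF that] by (intro least) (simp add: X.nrm_smult mult_left_mono)
    show "?N (\<lambda>i. a \<odot>\<^bsub>X i\<^esub> x i) = norm a * ?N x"
    proof (cases "a = 0")
      case True
      then show ?thesis using coord[OF x] by simp
    next
      case False
      \<comment> \<open>The reverse inequality is the one already shown, applied to the scaled
        vector and 1 / a.\<close>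
      have "?N (\<lambda>i. (1 / a) \<odot>\<^bsub>X i\<^esub> (a \<odot>\<^bsub>X i\<^esub> x i)) \<le> norm (1 / a) * ?N (\<lambda>i. a \<odot>\<^bsub>X i\<^esub> x i)"
        by (rule le[OF smult[OF x]])
      then have "?N x \<le> norm (1 / a) * ?N (\<lambda>i. a \<odot>\<^bsub>X i\<^esub> x i)"
        using False coord[OF x] by (simp add: X.smult_smult)
      then have "norm a * ?N x \<le> ?N (\<lambda>i. a \<odot>\<^bsub>X i\<^esub> x i)"
        using False by (simp add: norm_divide field_simps)
      with le[OF x, of a] show ?thesis by simp
    qed
  qed (use X.normed_space_axioms coord zero add smult in auto)
  interpret Y: normed_space ?Y by (rule Y)
  show ?thesis
  proof
    fix y i assume "y \<in> carrier ?Y"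
    then have y: "y \<in> C" by simp
    \<comment> \<open>C is only known to be closed under the operations, so the punctured vector is
      obtained by subtracting its i-th part.\<close>
    have "(\<lambda>j. y j \<oplus>\<^bsub>X j\<^esub> (- 1) \<odot>\<^bsub>X j\<^esub> (if j = i then y i else \<zero>\<^bsub>X j\<^esub>)) \<in> C"
      by (intro add smult single y coord)
    also have "(\<lambda>j. y j \<oplus>\<^bsub>X j\<^esub> (- 1) \<odot>\<^bsub>X j\<^esub> (if j = i then y i else \<zero>\<^bsub>X j\<^esub>)) = y(i := \<zero>\<^bsub>X i\<^esub>)"
      using coord[OF y] by (auto simp: fun_eq_iff)
    finally have d: "y(i := \<zero>\<^bsub>X i\<^esub>) \<in> C" .
    have "?N y = max (nrm (X i) (y i)) (?N (y(i := \<zero>\<^bsub>X i\<^esub>)))"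
    proof (rule antisym)
      show "?N y \<le> max (nrm (X i) (y i)) (?N (y(i := \<zero>\<^bsub>X i\<^esub>)))"
      proof (rule least)
        fix j
        show "nrm (X j) (y j) \<le> max (nrm (X i) (y i)) (?N (y(i := \<zero>\<^bsub>X i\<^esub>)))"
          using upper[OF d, of j] by (cases "j = i") auto
      qed
      have "?N (y(i := \<zero>\<^bsub>X i\<^esub>)) \<le> ?N y"
        using upper[OF y] N_nonneg[OF y] by (intro least) auto
      then show "max (nrm (X i) (y i)) (?N (y(i := \<zero>\<^bsub>X i\<^esub>))) \<le> ?N y" using upper[OF y] by simp
    qed
    then show "nrm ?Y y = max (nrm (X i) (y i)) (nrm ?Y (y(i := \<zero>\<^bsub>X i\<^esub>)))" by simp
  next
    fix v i assume v: "v \<in> carrier (X i)"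
    let ?s = "\<lambda>j. if j = i then v else \<zero>\<^bsub>X j\<^esub>"
    have "?N ?s = nrm (X i) v"
    proof (rule antisym)
      show "?N ?s \<le> nrm (X i) v" using v by (intro least) auto
      show "nrm (X i) v \<le> ?N ?s" using upper[OF single[OF v], of i] by simp
    qed
    then show "nrm ?Y ?s = nrm (X i) v" by simp
  qed (use coord single upper least in auto)
qed

text \<open>Removal of F is phrased as replacement by 0 on the full index type because vectors of
  the sum are total functions and the remainder must again be one.\<close>

lemma infsum_split_finite:
  fixes f :: "'a \<Rightarrow> real"
  assumes f: "f summable_on UNIV" and F: "finite F"
  shows "(\<lambda>i. if i \<in> F then 0 else f i) summable_on UNIV"
    and "infsum f UNIV = sum f F + (\<Sum>\<^sub>\<infinity>i. if i \<in> F then 0 else f i)"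
proof -
  have rest: "f summable_on - F" using summable_on_subset_banach[OF f] by simp
  have "f summable_on - F \<longleftrightarrow> (\<lambda>i. if i \<in> F then 0 else f i) summable_on UNIV"
    by (rule summable_on_cong_neutral) auto
  with rest show "(\<lambda>i. if i \<in> F then 0 else f i) summable_on UNIV" by simp
  have "infsum f (F \<union> - F) = infsum f F + infsum f (- F)"
    using F by (intro infsum_Un_disjoint rest) auto
  also have "infsum f (- F) = (\<Sum>\<^sub>\<infinity>i. if i \<in> F then 0 else f i)"
    by (rule infsum_cong_neutral) auto
  finally show "infsum f UNIV = sum f F + (\<Sum>\<^sub>\<infinity>i. if i \<in> F then 0 else f i)"
    using F by (simp add: Compl_partition)
qed

lemma l1_type_l1_sum:
  fixes X :: "'i \<Rightarrow> ('k::real_or_complex, 'v) nvs"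
  assumes X: "\<And>i. nontrivial_normed_space (X i)"
  shows "l1_type_sum X (l1_sum X)"
proof -
  interpret X: nontrivial_normed_space "X i" for i by (rule X)
  define C where "C = {x. (\<forall>i. x i \<in> carrier (X i)) \<and> (\<lambda>i. nrm (X i) (x i)) summable_on UNIV}"
  define N where "N x = (\<Sum>\<^sub>\<infinity>i. nrm (X i) (x i))" for x
  let ?Y = "sum_structure X C N"
  have Y_eq: "l1_sum X = ?Y" by (simp add: l1_sum_def C_def N_def[abs_def])
  have coord: "x i \<in> carrier (X i)" and summable: "(\<lambda>i. nrm (X i) (x i)) summable_on UNIV"
    if "x \<in> C" for x i
    using that by (auto simp: C_def)
  have split: "(\<lambda>i. if i \<in> F then \<zero>\<^bsub>X i\<^esub> else x i) \<in> C"
    "N x = (\<Sum>i\<in>F. nrm (X i) (x i)) + N (\<lambda>i. if i \<in> F then \<zero>\<^bsub>X i\<^esub> else x i)"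
    if x: "x \<in> C" and F: "finite F" for x F
  proof -
    have eq: "nrm (X i) (if i \<in> F then \<zero>\<^bsub>X i\<^esub> else x i) = (if i \<in> F then 0 else nrm (X i) (x i))" for i
      by simp
    show "(\<lambda>i. if i \<in> F then \<zero>\<^bsub>X i\<^esub> else x i) \<in> C"
      unfolding C_def using infsum_split_finite(1)[OF summable[OF x] F] coord[OF x]
      by (simp add: eq)
    show "N x = (\<Sum>i\<in>F. nrm (X i) (x i)) + N (\<lambda>i. if i \<in> F then \<zero>\<^bsub>X i\<^esub> else x i)"
      unfolding N_def eq by (rule infsum_split_finite(2)[OF summable[OF x] F])
  qed
  have N_nonneg: "0 \<le> N x" if "x \<in> C" for x
    unfolding N_def using coord[OF that] by (intro infsum_nonneg) simp
  have single: "(\<lambda>j. if j = i then v else \<zero>\<^bsub>X j\<^esub>) \<in> C" if "v \<in> carrier (X i)" for i v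
  proof -
    have "finite {j \<in> UNIV. nrm (X j) (if j = i then v else \<zero>\<^bsub>X j\<^esub>) \<noteq> 0}"
      by (rule finite_subset[of _ "{i}"]) auto
    then have "(\<lambda>j. nrm (X j) (if j = i then v else \<zero>\<^bsub>X j\<^esub>)) summable_on UNIV"
      by (rule finite_nonzero_values_imp_summable_on)
    then show ?thesis using that by (simp add: C_def)
  qed
  have zero: "(\<lambda>i. \<zero>\<^bsub>X i\<^esub>) \<in> C" by (simp add: C_def)
  have Y: "normed_space ?Y"
  proof (rule normed_space_sum_structure)
    fix x y assume xy: "x \<in> C" "y \<in> C"
    have s: "(\<lambda>i. nrm (X i) (x i) + nrm (X i) (y i)) summable_on UNIV"
      by (intro summable_on_add summable xy)
    have le: "nrm (X i) (x i \<oplus>\<^bsub>X i\<^esub> y i) \<le> nrm (X i) (x i) + nrm (X i) (y i)" for i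
      using coord xy by (intro X.nrm_triangle)
    have s': "(\<lambda>i. nrm (X i) (x i \<oplus>\<^bsub>X i\<^esub> y i)) summable_on UNIV"
      using coord xy by (intro summable_on_comparison_test[OF s le]) auto
    then show "(\<lambda>i. x i \<oplus>\<^bsub>X i\<^esub> y i) \<in> C" using coord xy by (simp add: C_def)
    have "N (\<lambda>i. x i \<oplus>\<^bsub>X i\<^esub> y i) \<le> (\<Sum>\<^sub>\<infinity>i. nrm (X i) (x i) + nrm (X i) (y i))"
      unfolding N_def by (intro infsum_mono s s' le)
    also have "\<dots> = N x + N y" unfolding N_def by (intro infsum_add summable xy)
    finally show "N (\<lambda>i. x i \<oplus>\<^bsub>X i\<^esub> y i) \<le> N x + N y" .
  next
    fix a x assume x: "x \<in> C"
    have eq: "nrm (X i) (a \<odot>\<^bsub>X i\<^esub> x i) = norm a * nrm (X i) (x i)" for i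
      using coord[OF x] by (simp add: X.nrm_smult)
    show "(\<lambda>i. a \<odot>\<^bsub>X i\<^esub> x i) \<in> C"
      using coord[OF x] summable_on_cmult_right[OF summable[OF x]] by (simp add: C_def eq)
    show "N (\<lambda>i. a \<odot>\<^bsub>X i\<^esub> x i) = norm a * N x"
      unfolding N_def eq by (rule infsum_cmult_right) (rule summable[OF x])
  next
    fix x i assume "x \<in> C" "N x = 0"
    \<comment> \<open>With F = {i} the norm is a sum of two nonnegative terms.\<close>
    then show "nrm (X i) (x i) = 0"
      using split(2)[of x "{i}"] split(1)[of x "{i}"] N_nonneg X.nrm_nonneg[OF coord, of x i] by force
  qed (use X.normed_space_axioms coord zero in \<open>auto simp: N_def\<close>)
  interpret Y: normed_space ?Y by (rule Y)
  have drop: "y(i := \<zero>\<^bsub>X i\<^esub>) = (\<lambda>j. if j \<in> {i} then \<zero>\<^bsub>X j\<^esub> else y j)" for y i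
    by auto
  have nrm_split: "N y = nrm (X i) (y i) + N (y(i := \<zero>\<^bsub>X i\<^esub>))" if "y \<in> C" for y i
    unfolding drop using split(2)[OF that, of "{i}"] by simp
  show ?thesis
    unfolding Y_eq
  proof
    fix y and e :: real assume "y \<in> carrier ?Y" and e: "0 < e"
    then have y: "y \<in> C" by simp
    \<comment> \<open>Half of e, because the approximation is a non-strict bound and a strict one is
      required.\<close>
    obtain F where F: "finite F" "dist (\<Sum>i\<in>F. nrm (X i) (y i)) (N y) \<le> e / 2"
      unfolding N_def using infsum_finite_approximation[OF summable[OF y], of "e / 2"] e by auto
    then have "N (\<lambda>i. if i \<in> F then \<zero>\<^bsub>X i\<^esub> else y i) < e"
      using split(2)[OF y F(1)] e by (simp add: dist_real_def)
    then show "\<exists>F. finite F \<and> nrm ?Y (\<lambda>i. if i \<in> F then \<zero>\<^bsub>X i\<^esub> else y i) < e"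
      using F(1) by auto
  next
    fix v i assume v: "v \<in> carrier (X i)"
    let ?s = "\<lambda>j. if j = i then v else \<zero>\<^bsub>X j\<^esub>"
    have "?s(i := \<zero>\<^bsub>X i\<^esub>) = (\<lambda>j. \<zero>\<^bsub>X j\<^esub>)" by auto
    then have "N ?s = nrm (X i) v" using nrm_split[OF single[OF v], of i] by (simp add: N_def)
    then show "nrm ?Y ?s = nrm (X i) v" by simp
  next
    fix y i assume "y \<in> carrier ?Y"
    then have y: "y \<in> C" by simp
    then have "y(i := \<zero>\<^bsub>X i\<^esub>) \<in> C" unfolding drop by (rule split(1)) simp
    then show "nrm (X i) (y i) \<le> nrm ?Y y" using nrm_split[OF y, of i] N_nonneg by force
  qed (use coord single nrm_split in auto)
qed

lemma sup_type_linf_sum: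
  fixes X :: "'i \<Rightarrow> ('k::real_or_complex, 'v) nvs"
  assumes X: "\<And>i. nontrivial_normed_space (X i)"
  shows "sup_type_sum X (linf_sum X)"
proof -
  interpret X: nontrivial_normed_space "X i" for i by (rule X)
  define C where "C = {x. (\<forall>i. x i \<in> carrier (X i)) \<and> bdd_above (range (\<lambda>i. nrm (X i) (x i)))}"
  have CI: "x \<in> C" if "\<And>i. x i \<in> carrier (X i)" "\<And>i. nrm (X i) (x i) \<le> B" for x B
    using that bdd_aboveI2[of UNIV "\<lambda>i. nrm (X i) (x i)" B] by (simp add: C_def)
  have CD: "\<exists>B. \<forall>i. x i \<in> carrier (X i) \<and> nrm (X i) (x i) \<le> B" if "x \<in> C" for x
    using that by (auto simp: C_def bdd_above_def)
  have "sup_type_sum X (sum_structure X C (\<lambda>x. SUP i. nrm (X i) (x i)))"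
  proof (rule sup_type_sumI[OF X])
    fix x y assume "x \<in> C" "y \<in> C"
    then obtain A B where A: "\<And>i. x i \<in> carrier (X i)" "\<And>i. nrm (X i) (x i) \<le> A"
      and B: "\<And>i. y i \<in> carrier (X i)" "\<And>i. nrm (X i) (y i) \<le> B"
      using CD by metis
    show "(\<lambda>i. x i \<oplus>\<^bsub>X i\<^esub> y i) \<in> C"
    proof (rule CI)
      fix i
      show "nrm (X i) (x i \<oplus>\<^bsub>X i\<^esub> y i) \<le> A + B"
        using X.nrm_triangle[OF A(1) B(1), of i] A(2)[of i] B(2)[of i] by simp
    qed (simp add: A B)
  next
    fix a x assume "x \<in> C"
    then obtain A where A: "\<And>i. x i \<in> carrier (X i)" "\<And>i. nrm (X i) (x i) \<le> A"
      using CD by metis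
    show "(\<lambda>i. a \<odot>\<^bsub>X i\<^esub> x i) \<in> C"
      using A by (intro CI[of _ "norm a * A"]) (auto simp: X.nrm_smult mult_left_mono)
  next
    fix i v assume "v \<in> carrier (X i)"
    then show "(\<lambda>j. if j = i then v else \<zero>\<^bsub>X j\<^esub>) \<in> C"
      by (intro CI[of _ "nrm (X i) v"]) auto
  qed (auto simp: C_def)
  then show ?thesis by (simp add: linf_sum_def C_def)
qed

lemma sup_type_c0_sum:
  fixes X :: "'i \<Rightarrow> ('k::real_or_complex, 'v) nvs"
  assumes X: "\<And>i. nontrivial_normed_space (X i)"
  shows "sup_type_sum X (c0_sum X)"
proof -
  interpret X: nontrivial_normed_space "X i" for i by (rule X)
  define C where "C = {x. (\<forall>i. x i \<in> carrier (X i)) \<and> (\<forall>e>0. finite {i. nrm (X i) (x i) \<ge> e})}"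
  have fin: "finite {i. nrm (X i) (x i) \<ge> e}" if "x \<in> C" "0 < e" for x e
    using that by (simp add: C_def)
  have coord: "x i \<in> carrier (X i)" if "x \<in> C" for x i
    using that by (simp add: C_def)
  have "sup_type_sum X (sum_structure X C (\<lambda>x. SUP i. nrm (X i) (x i)))"
  proof (rule sup_type_sumI)
    fix x y assume xy: "x \<in> C" "y \<in> C"
    have "finite {i. nrm (X i) (x i \<oplus>\<^bsub>X i\<^esub> y i) \<ge> e}" if e: "0 < e" for e
    proof (rule finite_subset)
      show "{i. nrm (X i) (x i \<oplus>\<^bsub>X i\<^esub> y i) \<ge> e}
          \<subseteq> {i. nrm (X i) (x i) \<ge> e / 2} \<union> {i. nrm (X i) (y i) \<ge> e / 2}"
      proof
        fix i assume "i \<in> {i. nrm (X i) (x i \<oplus>\<^bsub>X i\<^esub> y i) \<ge> e}"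
        then have "e \<le> nrm (X i) (x i) + nrm (X i) (y i)"
          using X.nrm_triangle[OF coord[OF xy(1)] coord[OF xy(2)], of i] by simp
        then show "i \<in> {i. nrm (X i) (x i) \<ge> e / 2} \<union> {i. nrm (X i) (y i) \<ge> e / 2}" by auto
      qed
    qed (intro finite_UnI fin xy half_gt_zero e)
    then show "(\<lambda>i. x i \<oplus>\<^bsub>X i\<^esub> y i) \<in> C" using coord xy by (simp add: C_def)
  next
    fix a x assume x: "x \<in> C"
    have "finite {i. nrm (X i) (a \<odot>\<^bsub>X i\<^esub> x i) \<ge> e}" if e: "0 < e" for e
    proof (cases "a = 0")
      case True
      then show ?thesis using e coord[OF x] by (simp add: not_le)
    next
      case False
      then have "{i. nrm (X i) (a \<odot>\<^bsub>X i\<^esub> x i) \<ge> e} = {i. nrm (X i) (x i) \<ge> e / norm a}"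
        using coord[OF x] by (auto simp: X.nrm_smult field_simps)
      then show ?thesis using fin[OF x] e False by simp
    qed
    then show "(\<lambda>i. a \<odot>\<^bsub>X i\<^esub> x i) \<in> C" using coord[OF x] by (simp add: C_def)
  next
    fix i v assume "v \<in> carrier (X i)"
    moreover have "finite {j. nrm (X j) (if j = i then v else \<zero>\<^bsub>X j\<^esub>) \<ge> e}" if "0 < e" for e
      by (rule finite_subset[of _ "{i}"]) (use that in \<open>auto split: if_splits\<close>)
    ultimately show "(\<lambda>j. if j = i then v else \<zero>\<^bsub>X j\<^esub>) \<in> C" by (simp add: C_def)
  next
    fix x assume x: "x \<in> C"
    let ?F = "{i. nrm (X i) (x i) \<ge> 1}"
    \<comment> \<open>Only finitely many coordinates have norm at least 1; their sum bounds each of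
      them, and the 1 takes care of all others.\<close>
    have "nrm (X i) (x i) \<le> 1 + (\<Sum>j\<in>?F. nrm (X j) (x j))" for i
    proof (cases "i \<in> ?F")
      case True
      then have "nrm (X i) (x i) \<le> (\<Sum>j\<in>?F. nrm (X j) (x j))"
        using coord[OF x] fin[OF x, of 1] by (intro member_le_sum) auto
      then show ?thesis by simp
    next
      case False
      moreover have "0 \<le> (\<Sum>j\<in>?F. nrm (X j) (x j))" using coord[OF x] by (intro sum_nonneg) simp
      ultimately show ?thesis by simp
    qed
    then show "bdd_above (range (\<lambda>i. nrm (X i) (x i)))" by (rule bdd_aboveI2)
  qed (use X coord in auto)
  then show ?thesis by (simp add: c0_sum_def C_def)
qed

section \<open>The joint index of the sum\<close>

theorem corollary3p5:
  fixes X :: "'i \<Rightarrow> ('k::real_or_complex, 'v) nvs"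
    and Y :: "('k, 'i \<Rightarrow> 'v) nvs"
    and p :: real and k :: nat
  assumes "\<And>i. banach_space (X i)"
    and "\<And>i. carrier (X i) \<noteq> {\<zero>\<^bsub>X i\<^esub>}"
    and "1 \<le> p" and "1 \<le> k"
    and "Y \<in> {l1_sum X, linf_sum X, c0_sum X}"
  shows "(numerical_index Y = 1 \<and>
           (\<exists>i0. joint_numerical_index p k (X i0) = 1 / real k powr (1 / p))
             \<longrightarrow> joint_numerical_index p k Y = 1 / real k powr (1 / p)) \<and>
         ((\<forall>i. joint_numerical_index p k (X i) = numerical_index (X i) / real k powr (1 / p))
             \<longrightarrow> joint_numerical_index p k Y = numerical_index Y / real k powr (1 / p))"
proof -
  have X: "nontrivial_normed_space (X i)" for i
    using assms(1,2) banach_space.axioms(1)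
    by (intro nontrivial_normed_space.intro nontrivial_normed_space_axioms.intro) auto
  have p: "0 < p" using assms(3) by simp
  consider "l1_type_sum X Y" | "sup_type_sum X Y"
    using assms(5) l1_type_l1_sum[of X, OF X] sup_type_linf_sum[of X, OF X] sup_type_c0_sum[of X, OF X]
    by auto
  \<comment> \<open>These three facts are all that is kept of the type of the sum.\<close>
  then have "nontrivial_normed_space Y \<and>
    (\<forall>i. joint_numerical_index p k Y \<le> joint_numerical_index p k (X i)) \<and>
    (\<forall>m\<ge>0. (\<forall>i. m \<le> numerical_index (X i)) \<longrightarrow> m \<le> numerical_index Y)"
  proof cases
    case 1
    then interpret l1_type_sum X Y .
    show ?thesis using Y_nontrivial joint_index_le[OF p assms(4)] index_ge by simp
  next
    case 2
    then interpret sup_type_sum X Y .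
    show ?thesis using Y_nontrivial joint_index_le[OF p assms(4)] index_ge by simp
  qed
  then have Y: "nontrivial_normed_space Y"
    and le: "\<And>i. joint_numerical_index p k Y \<le> joint_numerical_index p k (X i)"
    and ge: "\<And>m. 0 \<le> m \<Longrightarrow> (\<And>i. m \<le> numerical_index (X i)) \<Longrightarrow> m \<le> numerical_index Y"
    by simp_all
  interpret Y: nontrivial_normed_space Y by (rule Y)
  define c where "c = real k powr (1 / p)"
  have c: "0 < c" using assms(4) by (simp add: c_def)
  have lower: "numerical_index Y / c \<le> joint_numerical_index p k Y"
    unfolding c_def by (rule Y.numerical_index_le_joint[OF p assms(4)])
  have "joint_numerical_index p k Y = 1 / c"
    if "numerical_index Y = 1" "joint_numerical_index p k (X i0) = 1 / c" for i0
    using lower le[of i0] that by simp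
  moreover have "joint_numerical_index p k Y = numerical_index Y / c"
    if eq: "\<And>i. joint_numerical_index p k (X i) = numerical_index (X i) / c"
  proof (rule antisym)
    \<comment> \<open>The bound \<open>ge\<close> is used with m = n_(p,k)(Y) c, which lies below
      the numerical index of every summand. It demands m \<ge> 0, and this follows from the lower
      estimate.\<close>
    have "0 \<le> numerical_index Y / c" using Y.numerical_index_nonneg c by simp
    then have "0 \<le> joint_numerical_index p k Y * c" using lower c by simp
    moreover have "joint_numerical_index p k Y * c \<le> numerical_index (X i)" for i
      using le[of i] c by (simp add: eq field_simps)
    ultimately have "joint_numerical_index p k Y * c \<le> numerical_index Y" by (rule ge)
    then show "joint_numerical_index p k Y \<le> numerical_index Y / c" using c by (simp add: field_simps)
  qed (rule lower)
  ultimately show ?thesis unfolding c_def by blast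
qed

end
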